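(* Let $p$ be a generic $\Sigma$-singularity of a planar Filippov vector field $Z=(F^+,F^-)_f$. Then $I_p(Z)=0$ provided that $p$ is a regular-fold tangential singularity; $I_p(Z)=1$ provided that $p$ is a hyperbolic pseudo-node; and $I_p(Z)=-1$ provided that $p$ is a hyperbolic pseudo-saddle.
   Context: "Smooth" means $C^l$ with $l\ge 1$ large enough for the derivatives below to exist. For $u,v\in\mathbb{R}^2$, $(u|v)$ is the matrix with columns $u,v$. Planar Filippov vector field: $D\subset\mathbb{R}^2$ is open; $f:D\to\mathbb{R}$ is smooth with $0$ as a regular value; coordinates $(x,y)$ are such that $\Sigma:=f^{-1}(0)=D\cap\{y=0\}$, $f>0$ on $D\cap\{y>0\}$ and $f<0$ on $D\cap\{y<0\}$. Put $\Sigma^+=\{f\ge 0\}$, $\Sigma^-=\{f\le 0\}$. $F^\pm:D\to\mathbb{R}^2$ are smooth, and $Z=(F^+,F^-)_f$ equals $F^+$ on $\Sigma^+$ and $F^-$ on $\Sigma^-$ (two-valued on $\Sigma$), with Filippov's convention on $\Sigma$. Write $Ff(\mathbf{x})=\langle\nabla f(\mathbf{x}),F(\mathbf{x})\rangle$ and $F^2f=F(Ff)$. The sliding region is $\Sigma^s=\{\mathbf{x}\in\Sigma:F^+f<0,\ F^-f>0\}$, the escaping region is $\Sigma^e=\{\mathbf{x}\in\Sigma:F^+f>0,\ F^-f<0\}$, and on $\Sigma^s\cup\Sigma^e$ the sliding vector field is $Z^s=\dfrac{F^-f\,F^+-F^+f\,F^-}{F^-f-F^+f}$, which is tangent to $\Sigma$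 and is regarded as a scalar (its first component) function of $x$; $(Z^s)'$ is its derivative with respect to $x$. Singularities: $\mathbf{x}_0\in D$ is a singularity of $Z$ if (a) $\mathbf{x}_0\in\Sigma^+$ and $F^+(\mathbf{x}_0)=0$, or $\mathbf{x}_0\in\Sigma^-$ and $F^-(\mathbf{x}_0)=0$; or (b) $\mathbf{x}_0\in\Sigma^s\cup\Sigma^e$ and $Z^s(\mathbf{x}_0)=0$ (pseudo-equilibrium); or (c) $\mathbf{x}_0\in\Sigma$ and $F^+f(\mathbf{x}_0)=0$ or $F^-f(\mathbf{x}_0)=0$ (tangential singularity). A pseudo-equilibrium $p$ is hyperbolic if $(Z^s)'(p)\ne0$. A hyperbolic pseudo-equilibrium is a pseudo-saddle if $p\in\Sigma^s$ and $(Z^s)'(p)>0$, or $p\in\Sigma^e$ and $(Z^s)'(p)<0$; it is a pseudo-node if $p\in\Sigma^s$ and $(Z^s)'(p)<0$, or $p\in\Sigma^e$ and $(Z^s)'(p)>0$. A regular-fold tangential singularity is a point $p\in\Sigma$ such that either $F^+f(p)=0$, $(F^+)^2f(p)\ne0$, $F^-f(p)\neq0$; or $F^-f(p)=0$, $(F^-)^2f(p)\ne0$, $F^+f(p)\ne0$. A generic $\Sigma$-singularity is a hyperbolic pseudo-node, a hyperbolic pseudo-saddle, or a regular-fold tangential singularity. Index on a circle: let $B=B_r(\mathbf{x}_0)\subset D$ be a closed ball with center $\mathbf{x}_0=(a,b)$ and no singularities of $Z$ on $\partial B$. Define $$I_{\partial B}(Z)=\frac1{2\pi}\Big(J^+_{\partial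 B}(Z)+J^-_{\partial B}(Z)+\int_{\Gamma^+}\omega_W+\int_{\Gamma^-}\omega_W\Big),\quad \omega_W=\frac{-y\,dx+x\,dy}{x^2+y^2},$$ where $\Gamma^\pm$ is the image under $F^\pm$ of $\partial B\cap\Sigma^\pm$, traversed counterclockwise along $\partial B$, and $J^\pm_{\partial B}(Z)$ is as follows. If $|b|<r$, let $p^\pm=(a\pm\sqrt{r^2-b^2},0)$ be the right/left points of $\partial B\cap\Sigma$ (these are $(\pm r,0)$ when $\mathbf{x}_0=(0,0)$). If $\det(F^+(p^\pm)|F^-(p^\pm))=0$ then $J^\pm_{\partial B}(Z)=0$; otherwise $$J^\pm_{\partial B}(Z)=\pm\big(\tan^{-1}H_{(F^+,F^-)}(p^\pm)-\tan^{-1}H_{(F^-,F^+)}(p^\pm)\big),\quad H_{(F,G)}=\frac{\|F\|^2-\langle F,G\rangle}{\det(G|F)}.$$ If $|b|\ge r$, $J^\pm_{\partial B}(Z)=0$. Index at an isolated singularity $\mathbf{x}_0$: $I_{\mathbf{x}_0}(Z):=I_{\partial B_r(\mathbf{x}_0)}(Z)$ for any $r>0$ such that $\mathbf{x}_0$ is the unique singularity in $B_r(\mathbf{x}_0)\subset D$. *)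

theory Defs
  imports "HOL-Analysis.Analysis"
begin

definition C1_on :: "('a::real_normed_vector \<Rightarrow> 'b::real_normed_vector) \<Rightarrow> 'a set \<Rightarrow> bool" where
  "C1_on g S \<longleftrightarrow>
     (\<exists>g' :: 'a \<Rightarrow> 'a \<Rightarrow>\<^sub>L 'b.
        (\<forall>x\<in>S. (g has_derivative blinfun_apply (g' x)) (at x)) \<and> continuous_on S g')"

definition C2_on :: "('a::real_normed_vector \<Rightarrow> 'b::real_normed_vector) \<Rightarrow> 'a set \<Rightarrow> bool" where
  "C2_on g S \<longleftrightarrow>
     (\<exists>g' :: 'a \<Rightarrow> 'a \<Rightarrow>\<^sub>L 'b.
        (\<forall>x\<in>S. (g has_derivative blinfun_apply (g' x)) (at x)) \<and> C1_on g' S)"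

definition grad :: "(real^2 \<Rightarrow> real) \<Rightarrow> real^2 \<Rightarrow> real^2" where
  "grad g x = (\<chi> i. frechet_derivative g (at x) (axis i 1))"

definition lie_deriv :: "(real^2 \<Rightarrow> real^2) \<Rightarrow> (real^2 \<Rightarrow> real) \<Rightarrow> real^2 \<Rightarrow> real" where
  "lie_deriv F g x = grad g x \<bullet> F x"

definition col_matrix :: "real^2 \<Rightarrow> real^2 \<Rightarrow> real^2^2" where
  "col_matrix u v = transpose (vector [u, v])"

text \<open>The data of \<open>Z = (F\<^sup>+, F\<^sup>-)\<^sub>f\<close> on \<open>D\<close>. All three functions are total here; only
  their values on \<open>region Z\<close> are ever used.\<close>

record filippov =
  region :: "(real^2) set"
  switch :: "real^2 \<Rightarrow> real"
  Fplus :: "real^2 \<Rightarrow> real^2"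
  Fminus :: "real^2 \<Rightarrow> real^2"

text \<open>The Lie derivatives \<open>Ff\<close>, \<open>F\<^sup>2f\<close> and \<open>(Z\<^sup>s)'\<close> need \<open>f\<close> of class \<open>C\<^sup>2\<close> and
  \<open>F\<^sup>+\<close>, \<open>F\<^sup>-\<close> of class \<open>C\<^sup>1\<close>; nothing smoother is demanded.\<close>

definition planar_filippov :: "filippov \<Rightarrow> bool" where
  "planar_filippov Z \<longleftrightarrow>
     open (region Z) \<and>
     C2_on (switch Z) (region Z) \<and>
     C1_on (Fplus Z) (region Z) \<and>
     C1_on (Fminus Z) (region Z) \<and>
     (\<forall>x\<in>region Z. switch Z x = 0 \<longrightarrow> grad (switch Z) x \<noteq> 0) \<and>
     (\<forall>x\<in>region Z. switch Z x = 0 \<longleftrightarrow> x $ 2 = 0) \<and>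
     (\<forall>x\<in>region Z. x $ 2 > 0 \<longrightarrow> switch Z x > 0) \<and>
     (\<forall>x\<in>region Z. x $ 2 < 0 \<longrightarrow> switch Z x < 0)"

definition Sigma0 :: "filippov \<Rightarrow> (real^2) set" where
  "Sigma0 Z = {x \<in> region Z. switch Z x = 0}"

definition Sigma_plus :: "filippov \<Rightarrow> (real^2) set" where
  "Sigma_plus Z = {x \<in> region Z. switch Z x \<ge> 0}"

definition Sigma_minus :: "filippov \<Rightarrow> (real^2) set" where
  "Sigma_minus Z = {x \<in> region Z. switch Z x \<le> 0}"

abbreviation Lplus :: "filippov \<Rightarrow> real^2 \<Rightarrow> real" where
  "Lplus Z \<equiv> lie_deriv (Fplus Z) (switch Z)"

abbreviation Lminus :: "filippov \<Rightarrow> real^2 \<Rightarrow> real" where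
  "Lminus Z \<equiv> lie_deriv (Fminus Z) (switch Z)"

definition sliding_region :: "filippov \<Rightarrow> (real^2) set" where
  "sliding_region Z = {x \<in> Sigma0 Z. Lplus Z x < 0 \<and> Lminus Z x > 0}"

definition escaping_region :: "filippov \<Rightarrow> (real^2) set" where
  "escaping_region Z = {x \<in> Sigma0 Z. Lplus Z x > 0 \<and> Lminus Z x < 0}"

definition sliding_field :: "filippov \<Rightarrow> real^2 \<Rightarrow> real^2" where
  "sliding_field Z x =
     (1 / (Lminus Z x - Lplus Z x)) *\<^sub>R (Lminus Z x *\<^sub>R Fplus Z x - Lplus Z x *\<^sub>R Fminus Z x)"

definition sliding_deriv :: "filippov \<Rightarrow> real^2 \<Rightarrow> real" where
  "sliding_deriv Z p = deriv (\<lambda>s. sliding_field Z (vector [s, 0]) $ 1) (p $ 1)"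

definition pseudo_equilibrium :: "filippov \<Rightarrow> real^2 \<Rightarrow> bool" where
  "pseudo_equilibrium Z x \<longleftrightarrow>
     x \<in> sliding_region Z \<union> escaping_region Z \<and> sliding_field Z x = 0"

definition tangential_singularity :: "filippov \<Rightarrow> real^2 \<Rightarrow> bool" where
  "tangential_singularity Z x \<longleftrightarrow> x \<in> Sigma0 Z \<and> (Lplus Z x = 0 \<or> Lminus Z x = 0)"

definition singularity :: "filippov \<Rightarrow> real^2 \<Rightarrow> bool" where
  "singularity Z x \<longleftrightarrow>
     (x \<in> Sigma_plus Z \<and> Fplus Z x = 0) \<or>
     (x \<in> Sigma_minus Z \<and> Fminus Z x = 0) \<or>
     pseudo_equilibrium Z x \<or>
     tangential_singularity Z x"

definition hyperbolic_pseudo_equilibrium :: "filippov \<Rightarrow> real^2 \<Rightarrow> bool" where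
  "hyperbolic_pseudo_equilibrium Z p \<longleftrightarrow> pseudo_equilibrium Z p \<and> sliding_deriv Z p \<noteq> 0"

definition hyperbolic_pseudo_saddle :: "filippov \<Rightarrow> real^2 \<Rightarrow> bool" where
  "hyperbolic_pseudo_saddle Z p \<longleftrightarrow>
     hyperbolic_pseudo_equilibrium Z p \<and>
     (p \<in> sliding_region Z \<and> sliding_deriv Z p > 0 \<or>
      p \<in> escaping_region Z \<and> sliding_deriv Z p < 0)"

definition hyperbolic_pseudo_node :: "filippov \<Rightarrow> real^2 \<Rightarrow> bool" where
  "hyperbolic_pseudo_node Z p \<longleftrightarrow>
     hyperbolic_pseudo_equilibrium Z p \<and>
     (p \<in> sliding_region Z \<and> sliding_deriv Z p < 0 \<or>
      p \<in> escaping_region Z \<and> sliding_deriv Z p > 0)"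

definition regular_fold :: "filippov \<Rightarrow> real^2 \<Rightarrow> bool" where
  "regular_fold Z p \<longleftrightarrow>
     p \<in> Sigma0 Z \<and>
     (Lplus Z p = 0 \<and> lie_deriv (Fplus Z) (Lplus Z) p \<noteq> 0 \<and> Lminus Z p \<noteq> 0 \<or>
      Lminus Z p = 0 \<and> lie_deriv (Fminus Z) (Lminus Z) p \<noteq> 0 \<and> Lplus Z p \<noteq> 0)"

definition generic_Sigma_singularity :: "filippov \<Rightarrow> real^2 \<Rightarrow> bool" where
  "generic_Sigma_singularity Z p \<longleftrightarrow>
     hyperbolic_pseudo_node Z p \<or> hyperbolic_pseudo_saddle Z p \<or> regular_fold Z p"

definition circle :: "real^2 \<Rightarrow> real \<Rightarrow> real \<Rightarrow> real^2" where
  "circle c r t = c + r *\<^sub>R vector [cos t, sin t]"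

text \<open>The form \<open>(-y dx + x dy) / (x\<^sup>2 + y\<^sup>2)\<close> at the point \<open>w\<close>, applied to the vector \<open>v\<close>.\<close>

definition omega_W :: "real^2 \<Rightarrow> real^2 \<Rightarrow> real" where
  "omega_W w v = (- (w $ 2) * v $ 1 + w $ 1 * v $ 2) / ((w $ 1)\<^sup>2 + (w $ 2)\<^sup>2)"

text \<open>The integral of the form along the image under \<open>F\<close> of the part of the circle lying in \<open>S\<close>.
  The parameter set may consist of two intervals when that arc contains the point with
  parameter \<open>0\<close>; this does not affect the integral.\<close>

definition arc_integral ::
  "(real^2 \<Rightarrow> real^2) \<Rightarrow> (real^2) set \<Rightarrow> real^2 \<Rightarrow> real \<Rightarrow> real" where
  "arc_integral F S c r =
     integral {t \<in> {0..2 * pi}. circle c r t \<in> S}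
       (\<lambda>t. omega_W (F (circle c r t)) (vector_derivative (\<lambda>s. F (circle c r s)) (at t)))"

definition H_fun :: "(real^2 \<Rightarrow> real^2) \<Rightarrow> (real^2 \<Rightarrow> real^2) \<Rightarrow> real^2 \<Rightarrow> real" where
  "H_fun F G q = ((norm (F q))\<^sup>2 - F q \<bullet> G q) / det (col_matrix (G q) (F q))"

definition J_jump :: "filippov \<Rightarrow> real^2 \<Rightarrow> real" where
  "J_jump Z q =
     (if det (col_matrix (Fplus Z q) (Fminus Z q)) = 0 then 0
      else arctan (H_fun (Fplus Z) (Fminus Z) q) - arctan (H_fun (Fminus Z) (Fplus Z) q))"

definition J_plus :: "filippov \<Rightarrow> real^2 \<Rightarrow> real \<Rightarrow> real" where
  "J_plus Z c r =
     (if \<bar>c $ 2\<bar> < r then J_jump Z (vector [c $ 1 + sqrt (r\<^sup>2 - (c $ 2)\<^sup>2), 0]) else 0)"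

definition J_minus :: "filippov \<Rightarrow> real^2 \<Rightarrow> real \<Rightarrow> real" where
  "J_minus Z c r =
     (if \<bar>c $ 2\<bar> < r then - J_jump Z (vector [c $ 1 - sqrt (r\<^sup>2 - (c $ 2)\<^sup>2), 0]) else 0)"

definition circle_index :: "filippov \<Rightarrow> real^2 \<Rightarrow> real \<Rightarrow> real" where
  "circle_index Z c r =
     1 / (2 * pi) *
       (J_plus Z c r + J_minus Z c r
        + arc_integral (Fplus Z) (Sigma_plus Z) c r
        + arc_integral (Fminus Z) (Sigma_minus Z) c r)"

definition isolating_radius :: "filippov \<Rightarrow> real^2 \<Rightarrow> real \<Rightarrow> bool" where
  "isolating_radius Z p r \<longleftrightarrow>
     r > 0 \<and> cball p r \<subseteq> region Z \<and> {x \<in> cball p r. singularity Z x} = {p}"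

text \<open>\<open>has_index Z p k\<close> says that \<open>I\<^sub>p(Z)\<close> is defined and equal to \<open>k\<close>: the point \<open>p\<close> is an
  isolated singularity, and every isolating circle around it gives the value \<open>k\<close>.\<close>

definition has_index :: "filippov \<Rightarrow> real^2 \<Rightarrow> real \<Rightarrow> bool" where
  "has_index Z p k \<longleftrightarrow>
     (\<exists>r. isolating_radius Z p r) \<and>
     (\<forall>r. isolating_radius Z p r \<longrightarrow> circle_index Z p r = k)"

end

theory Submission
  imports Defs
begin

text \<open>Let \<open>p = (a, 0)\<close> and fix an isolating circle of radius \<open>r\<close>. Neither \<open>F\<^sup>+\<close> nor \<open>F\<^sup>-\<close> vanishes
  at a generic \<open>\<Sigma>\<close>-singularity, so \<open>F\<^sup>+\<close> has no zero on the closed upper half disc and \<open>F\<^sup>-\<close> none on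
  the lower one. Half discs are convex, hence both fields have continuous complex logarithms there,
  and the integral of \<open>\<omega>\<^sub>W\<close> along a half circle is the difference of the imaginary parts of
  the logarithm at the two points \<open>(a \<plusminus> r, 0)\<close>. The jump terms \<open>J\<^sup>\<plusminus>\<close> are, up to sign, the
  principal value of the angle from \<open>F\<^sup>-\<close> to \<open>F\<^sup>+\<close> at these points
  (\<open>arctan_H_diff_eq_Arg\<close>): the two arctangents are complements of the other two angles of the
  triangle with vertices \<open>0\<close>, \<open>F\<^sup>+\<close>, \<open>F\<^sup>-\<close>.

  Let \<open>\<phi>\<close> be the difference of the two arguments along the diameter on \<open>\<Sigma>\<close>, a continuous function.
  The four terms of the index then cancel except for multiples of \<open>2\<pi>\<close>, and the index is the
  difference of \<open>\<lfloor>(\<phi> + \<pi>) / 2\<pi>\<rfloor>\<close> between the left and the right endpoint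
  (\<open>circle_index_eq_floor_diff\<close>). It counts how often \<open>F\<^sup>+\<close> and \<open>F\<^sup>-\<close> become antiparallel along the
  diameter, with sign. Antiparallel vectors on \<open>\<Sigma>\<close> force a singularity
  (\<open>nonpos_ratio_imp_singularity\<close>), so this can happen only at \<open>p\<close>.

  At a regular fold exactly one of the two fields is tangent to \<open>\<Sigma>\<close>, the fields are not parallel, and
  the index is \<open>0\<close>. At a pseudo-equilibrium the fields are antiparallel, and everywhere on the
  diameter they point to opposite sides of \<open>\<Sigma>\<close>, so they are never parallel in the same direction:
  \<open>\<phi>\<close> stays between two consecutive multiples of \<open>2\<pi>\<close>, and the index is decided by the sign of
  \<open>sin \<phi>\<close> at the endpoints, that is, by the sign of \<open>det (F\<^sup>+|F\<^sup>-)\<close>. On \<open>\<Sigma>\<close> the sliding field is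
  \<open>det (F\<^sup>+|F\<^sup>-) / (F\<^sup>-\<^sub>2 - F\<^sup>+\<^sub>2)\<close>, so the determinant changes sign at a hyperbolic
  pseudo-equilibrium, downwards for a node and upwards for a saddle, in the sliding region as well as
  in the escaping region.\<close>

section \<open>Plane vectors and complex numbers\<close>

definition xaxis :: "real \<Rightarrow> real^2" where
  "xaxis s = vector [s, 0]"

definition cplx :: "real^2 \<Rightarrow> complex" where
  "cplx v = Complex (v $ 1) (v $ 2)"

definition cross :: "real^2 \<Rightarrow> real^2 \<Rightarrow> real" where
  "cross u v = u $ 1 * v $ 2 - v $ 1 * u $ 2"

lemma vec2_eq_iff: "(u::real^2) = v \<longleftrightarrow> u $ 1 = v $ 1 \<and> u $ 2 = v $ 2"
  by (simp add: vec_eq_iff forall_2)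

lemma vec2_decomp: "(v::real^2) = v $ 1 *\<^sub>R axis 1 1 + v $ 2 *\<^sub>R axis 2 1"
  by (simp add: vec2_eq_iff axis_def)

lemma inner_vec2: "(u::real^2) \<bullet> v = u $ 1 * v $ 1 + u $ 2 * v $ 2"
  by (simp add: inner_vec_def sum_2)

lemma norm_vec2: "(norm (v::real^2))\<^sup>2 = (v $ 1)\<^sup>2 + (v $ 2)\<^sup>2"
  unfolding power2_norm_eq_inner inner_vec2 by (simp add: power2_eq_square)

lemma xaxis_nth [simp]: "xaxis s $ 1 = s" "xaxis s $ 2 = 0"
  by (simp_all add: xaxis_def)

lemma xaxis_of_nth: "p $ 2 = 0 \<Longrightarrow> xaxis (p $ 1) = p"
  by (simp add: vec2_eq_iff)

lemma dist_xaxis: "dist (xaxis s) (xaxis t) = \<bar>s - t\<bar>"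
proof -
  have "xaxis s - xaxis t = (s - t) *\<^sub>R axis 1 1"
    by (simp add: vec2_eq_iff axis_def)
  then show ?thesis by (simp add: dist_norm)
qed

lemma has_vector_derivative_xaxis:
  "(xaxis has_vector_derivative axis 1 1) (at s within S)"
proof -
  have *: "xaxis = (\<lambda>s. s *\<^sub>R axis 1 1)"
    by (rule ext) (simp add: vec2_eq_iff axis_def)
  show ?thesis unfolding * by (auto intro!: derivative_eq_intros)
qed

lemma continuous_on_xaxis: "continuous_on S xaxis"
  by (meson has_vector_derivative_xaxis has_vector_derivative_continuous continuous_on_eq_continuous_within)

lemma bounded_linear_cplx: "bounded_linear cplx"
  unfolding linear_conv_bounded_linear [symmetric]
  by (auto simp: linear_iff cplx_def complex_eq_iff)

lemma cplx_eq_0_iff [simp]: "cplx v = 0 \<longleftrightarrow> v = 0"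
  by (auto simp: cplx_def complex_eq_iff vec2_eq_iff)

lemma cplx_sel [simp]: "Re (cplx v) = v $ 1" "Im (cplx v) = v $ 2"
  by (simp_all add: cplx_def)

lemma det_col_matrix: "det (col_matrix u v) = cross u v"
  by (simp add: col_matrix_def det_2 transpose_def cross_def)

lemma omega_W_eq_Im: "omega_W w v = Im (cplx v / cplx w)"
  by (simp add: omega_W_def Im_divide algebra_simps)

section \<open>Lifted arguments\<close>

text \<open>A continuous logarithm of a differentiable curve agrees near each point with a branch of \<open>Ln\<close>,
  up to a constant; so it inherits differentiability, and its derivative is the logarithmic
  derivative of the curve.\<close>

lemma has_vector_derivative_continuous_log:
  fixes \<gamma> l :: "real \<Rightarrow> complex"
  assumes cont: "continuous_on {a..b} l" and t: "t \<in> {a..b}"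
    and lift: "\<And>s. s \<in> {a..b} \<Longrightarrow> \<gamma> s = exp (l s)"
    and der: "(\<gamma> has_vector_derivative \<gamma>') (at t within {a..b})"
  shows "(l has_vector_derivative \<gamma>' / \<gamma> t) (at t within {a..b})"
proof -
  obtain d where d: "d > 0"
    "\<And>s. s \<in> {a..b} \<Longrightarrow> dist s t < d \<Longrightarrow> dist (l s) (l t) < pi"
    using cont t pi_gt_zero unfolding continuous_on_iff by metis
  have nz: "\<gamma> t \<noteq> 0" using lift t by simp
  have "((\<lambda>s. \<gamma> s / \<gamma> t) has_vector_derivative \<gamma>' / \<gamma> t) (at t within {a..b})"
    using der by (rule has_vector_derivative_divide)
  moreover have "(Ln has_field_derivative inverse (\<gamma> t / \<gamma> t)) (at (\<gamma> t / \<gamma> t))"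
    by (rule has_field_derivative_Ln) (use nz in auto)
  ultimately have "(Ln \<circ> (\<lambda>s. \<gamma> s / \<gamma> t) has_vector_derivative
      \<gamma>' / \<gamma> t * inverse (\<gamma> t / \<gamma> t)) (at t within {a..b})"
    by (intro field_vector_diff_chain_within) (auto intro: has_field_derivative_at_within)
  \<comment> \<open>The branch of the logarithm that takes the value \<open>l t\<close> at \<open>t\<close>; it agrees with \<open>l\<close> near \<open>t\<close>.\<close>
  then have "((\<lambda>s. l t + Ln (\<gamma> s / \<gamma> t)) has_vector_derivative \<gamma>' / \<gamma> t) (at t within {a..b})"
    using nz by (auto simp: o_def intro!: derivative_eq_intros)
  then show ?thesis
  proof (rule has_vector_derivative_transform_within [OF _ d(1) t])
    fix s assume s: "s \<in> {a..b}" "dist s t < d"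
    have "\<bar>Im (l s - l t)\<bar> < pi"
      using d(2) [OF s] abs_Im_le_cmod [of "l s - l t"] by (simp add: dist_norm)
    then have "Ln (exp (l s - l t)) = l s - l t" by (intro Ln_exp) auto
    then show "l t + Ln (\<gamma> s / \<gamma> t) = l s"
      using lift s t by (simp add: exp_diff)
  qed
qed

text \<open>The intermediate value theorem, in the form that turns a lifted angle avoiding one direction into
  an integer that is the same at both ends.\<close>

lemma floor_eq_of_avoids_Ints:
  fixes u :: "real \<Rightarrow> real"
  assumes "continuous_on {a..b} u" "a \<le> b" "\<And>x. x \<in> {a..b} \<Longrightarrow> u x \<notin> \<int>"
  shows "\<lfloor>u a\<rfloor> = \<lfloor>u b\<rfloor>"
proof (rule ccontr)
  assume "\<lfloor>u a\<rfloor> \<noteq> \<lfloor>u b\<rfloor>"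
  then consider "\<lfloor>u a\<rfloor> < \<lfloor>u b\<rfloor>" | "\<lfloor>u b\<rfloor> < \<lfloor>u a\<rfloor>" by linarith
  then have "\<exists>x\<in>{a..b}. u x \<in> \<int>"
  proof cases
    case 1
    then have "u a \<le> of_int \<lfloor>u b\<rfloor>" "of_int \<lfloor>u b\<rfloor> \<le> u b" by linarith+
    from IVT' [OF this assms(2,1)] show ?thesis
      using atLeastAtMost_iff by (metis Ints_of_int)
  next
    case 2
    then have "u b \<le> of_int \<lfloor>u a\<rfloor>" "of_int \<lfloor>u a\<rfloor> \<le> u a" by linarith+
    from IVT2' [OF this assms(2,1)] show ?thesis
      using atLeastAtMost_iff by (metis Ints_of_int)
  qed
  then show False using assms(3) by blast
qed

text \<open>The excluded case is that \<open>exp z\<close> lies on the cut of \<open>Arg\<close>; off the cut, the floor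
  counts the full turns between a lifted argument and the principal one.\<close>

lemma Arg_exp_eq:
  assumes "(Im z + pi) / (2 * pi) \<notin> \<int>"
  shows "Arg (exp z) = Im z - 2 * pi * of_int \<lfloor>(Im z + pi) / (2 * pi)\<rfloor>"
proof -
  define k where "k = \<lfloor>(Im z + pi) / (2 * pi)\<rfloor>"
  have "of_int k \<le> (Im z + pi) / (2 * pi)" "(Im z + pi) / (2 * pi) < of_int k + 1"
    unfolding k_def by linarith+
  moreover have "of_int k \<noteq> (Im z + pi) / (2 * pi)" using assms by (metis Ints_of_int)
  ultimately have k: "of_int k < (Im z + pi) / (2 * pi)" "(Im z + pi) / (2 * pi) < of_int k + 1"
    by linarith+
  have "cis (Im z - 2 * pi * of_int k) = cis (Im z)"
    by (simp add: cis_divide [symmetric] cis_multiple_2pi)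
  then have "sgn (exp z) = cis (Im z - 2 * pi * of_int k)"
    by (simp add: sgn_div_norm exp_eq_polar scaleR_conv_of_real norm_mult divide_simps)
  moreover have "- pi < Im z - 2 * pi * of_int k" "Im z - 2 * pi * of_int k \<le> pi"
    using k pi_gt_zero by (simp_all add: field_simps)
  ultimately show ?thesis unfolding k_def [symmetric] by (intro cis_Arg_unique) auto
qed

lemma exp_in_nonpos_Reals:
  assumes "(Im z + pi) / (2 * pi) \<in> \<int>"
  shows "exp z \<in> \<real>\<^sub>\<le>\<^sub>0"
proof -
  from assms obtain k :: int where "(Im z + pi) / (2 * pi) = of_int k" by (auto elim: Ints_cases)
  then have "Im z = 2 * pi * of_int k - pi" by (simp add: field_simps)
  then have "cis (Im z) = - 1"
    by (simp add: cis_divide [symmetric])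
  then have "exp z = - of_real (exp (Re z))" by (simp add: exp_eq_polar)
  then show ?thesis by (simp add: complex_nonpos_Reals_iff)
qed

lemma exp_Im_in_Ints:
  assumes "Im z / (2 * pi) \<in> \<int>"
  shows "exp z = of_real (exp (Re z))"
proof -
  from assms obtain k :: int where "Im z / (2 * pi) = of_int k" by (auto elim: Ints_cases)
  then have "Im z = 2 * pi * of_int k" by (simp add: field_simps)
  then have "cis (Im z) = 1" by simp
  then show ?thesis by (simp add: exp_eq_polar)
qed

text \<open>Shifting an angle by half a turn completes a full turn exactly when the angle is in the lower half
  plane, that is, when its sine is negative.\<close>

lemma floor_plus_half:
  shows "sin (2 * pi * v) > 0 \<Longrightarrow> \<lfloor>v + 1/2\<rfloor> = \<lfloor>v\<rfloor>"
    and "sin (2 * pi * v) < 0 \<Longrightarrow> \<lfloor>v + 1/2\<rfloor> = \<lfloor>v\<rfloor> + 1"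
proof -
  define f where "f = v - of_int \<lfloor>v\<rfloor>"
  have f: "0 \<le> f" "f < 1" unfolding f_def by linarith+
  have "2 * pi * v = 2 * pi * of_int \<lfloor>v\<rfloor> + 2 * pi * f"
    by (simp add: f_def algebra_simps)
  then have sin_f: "sin (2 * pi * v) = sin (2 * pi * f)"
    by (simp add: sin_add)
  {
    assume "sin (2 * pi * v) > 0"
    then have "\<not> f \<ge> 1/2"
      using sin_le_zero [of "2 * pi * f"] f by (auto simp: sin_f)
    then show "\<lfloor>v + 1/2\<rfloor> = \<lfloor>v\<rfloor>"
      using f unfolding f_def by linarith
  next
    assume "sin (2 * pi * v) < 0"
    then have "\<not> f \<le> 1/2"
      using sin_ge_zero [of "2 * pi * f"] f by (auto simp: sin_f)
    then show "\<lfloor>v + 1/2\<rfloor> = \<lfloor>v\<rfloor> + 1"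
      using f unfolding f_def by linarith
  }
qed

section \<open>The jump terms as principal angles\<close>

text \<open>Writing \<open>X\<close>, \<open>Y\<close> for the two arguments of \<open>arctan\<close> (the second with its sign changed), the
  number \<open>(1 + \<i>X) (1 + \<i>Y)\<close> is a positive multiple of the quotient of the two vectors: \<open>X + Y\<close> is
  \<open>\<bar>F - G\<bar>\<^sup>2 / det\<close>, and \<open>1 - X Y\<close> is \<open>\<bar>F - G\<bar>\<^sup>2 (F \<bullet> G) / det\<^sup>2\<close> by Lagrange's identity
  \<open>\<bar>F\<bar>\<^sup>2 \<bar>G\<bar>\<^sup>2 = (F \<bullet> G)\<^sup>2 + det\<^sup>2\<close>. Since \<open>arctan X + arctan Y\<close> lies in \<open>(-\<pi>, \<pi>)\<close>, it is the principal argument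
  without correction.\<close>

lemma arctan_H_diff_eq_Arg:
  assumes "cross G F \<noteq> 0"
  shows "arctan (((norm F)\<^sup>2 - F \<bullet> G) / cross G F) - arctan (((norm G)\<^sup>2 - G \<bullet> F) / cross F G)
    = Arg (cplx F / cplx G)"
proof -
  define c where "c = cross G F"
  define X where "X = ((norm F)\<^sup>2 - F \<bullet> G) / c"
  define Y where "Y = ((norm G)\<^sup>2 - F \<bullet> G) / c"
  define N where "N = (norm (F - G))\<^sup>2"
  have c: "c \<noteq> 0" "cross F G = - c" using assms by (auto simp: c_def cross_def)
  have G: "G \<noteq> 0" and FG: "F \<noteq> G" using assms by (auto simp: cross_def)
  then have N: "N > 0" by (simp add: N_def)
  have lhs: "arctan (((norm F)\<^sup>2 - F \<bullet> G) / cross G F) - arctan (((norm G)\<^sup>2 - G \<bullet> F) / cross F G)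
     = arctan X + arctan Y"
    using c arctan_minus [of Y] by (simp add: X_def Y_def c_def [symmetric] inner_commute)
  \<comment> \<open>\<open>arctan t\<close> is the argument of \<open>1 + \<i>t\<close>.\<close>
  have cis_arctan: "Complex 1 t = of_real (sqrt (1 + t\<^sup>2)) * cis (arctan t)" for t
    using sum_power2_gt_zero_iff [of 1 t]
    by (auto simp: complex_eq_iff cos_arctan sin_arctan)
  have "X + Y = N / c"
    unfolding X_def Y_def N_def norm_vec2 inner_vec2 add_divide_distrib [symmetric]
    by (simp add: algebra_simps power2_eq_square)
  moreover have "1 - X * Y = N * (F \<bullet> G) / c\<^sup>2"
  proof -
    have "c\<^sup>2 - ((norm F)\<^sup>2 - F \<bullet> G) * ((norm G)\<^sup>2 - F \<bullet> G) = N * (F \<bullet> G)"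
      unfolding N_def norm_vec2 inner_vec2 c_def cross_def by (simp, algebra)
    moreover have "1 - X * Y = (c\<^sup>2 - ((norm F)\<^sup>2 - F \<bullet> G) * ((norm G)\<^sup>2 - F \<bullet> G)) / c\<^sup>2"
      using c by (simp add: X_def Y_def divide_simps power2_eq_square)
    ultimately show ?thesis by simp
  qed
  moreover have "Complex 1 X * Complex 1 Y = Complex (1 - X * Y) (X + Y)"
    by (simp add: complex_eq_iff)
  moreover have "cplx F / cplx G = Complex (F \<bullet> G) c / of_real ((norm G)\<^sup>2)"
  proof -
    have "cplx F * cnj (cplx G) = Complex (F \<bullet> G) c"
      by (simp add: complex_eq_iff inner_vec2 c_def cross_def algebra_simps)
    moreover have "(cmod (cplx G))\<^sup>2 = (norm G)\<^sup>2"
      by (simp add: cmod_power2 norm_vec2)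
    ultimately show ?thesis
      by (simp only: complex_div_cnj [of "cplx F" "cplx G"] of_real_power [symmetric])
  qed
  ultimately have "cplx F / cplx G = of_real (c\<^sup>2 / (N * (norm G)\<^sup>2)) * (Complex 1 X * Complex 1 Y)"
    using c(1) G N by (simp only:) (simp add: complex_eq_iff power2_eq_square)
  also have "\<dots> = rcis (c\<^sup>2 / (N * (norm G)\<^sup>2) * (sqrt (1 + X\<^sup>2) * sqrt (1 + Y\<^sup>2))) (arctan X + arctan Y)"
    unfolding cis_arctan rcis_def cis_mult [symmetric] by (simp add: mult_ac)
  finally have *: "cplx F / cplx G = \<dots>" .
  have pos: "0 < c\<^sup>2 / (N * (norm G)\<^sup>2) * (sqrt (1 + X\<^sup>2) * sqrt (1 + Y\<^sup>2))"
    using c G N by (simp add: add_pos_nonneg)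
  have "arctan X + arctan Y \<in> {- pi<..pi}"
    using arctan_bounded [of X] arctan_bounded [of Y] by auto
  from Arg_unique' [OF pos this *] lhs show ?thesis by simp
qed

text \<open>The convention that the jump is \<open>0\<close> for parallel vectors fits the angle formula exactly when the
  two vectors point in the same direction.\<close>

lemma J_jump_eq_Arg:
  assumes "cplx (Fplus Z q) / cplx (Fminus Z q) \<notin> \<real>\<^sub>\<le>\<^sub>0"
  shows "J_jump Z q = Arg (cplx (Fplus Z q) / cplx (Fminus Z q))"
proof (cases "cross (Fplus Z q) (Fminus Z q) = 0")
  case True
  then have "Im (cplx (Fplus Z q) / cplx (Fminus Z q)) = 0"
    by (simp add: Im_divide cross_def algebra_simps)
  with assms have "Arg (cplx (Fplus Z q) / cplx (Fminus Z q)) = 0"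
    by (auto simp: Arg_eq_0 complex_nonpos_Reals_iff complex_is_Real_iff)
  with True show ?thesis by (simp add: J_jump_def det_col_matrix)
next
  case False
  then have "cross (Fminus Z q) (Fplus Z q) \<noteq> 0" by (simp add: cross_def)
  from arctan_H_diff_eq_Arg [OF this] False show ?thesis
    by (simp add: J_jump_def det_col_matrix H_fun_def)
qed

section \<open>The integral of the angular form along half circles\<close>

lemma circle_nth [simp]:
  "circle p r t $ 1 = p $ 1 + r * cos t" "circle p r t $ 2 = p $ 2 + r * sin t"
  by (simp_all add: circle_def)

lemma circle_in_cball: "r \<ge> 0 \<Longrightarrow> circle p r t \<in> cball p r"
proof -
  assume r: "r \<ge> 0"
  have "(norm (vector [cos t, sin t] :: real^2))\<^sup>2 = 1"
    by (simp add: norm_vec2)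
  then have "norm (vector [cos t, sin t] :: real^2) = 1"
    by (simp add: abs_square_eq_1 power2_eq_1_iff)
  then show ?thesis using r by (simp add: circle_def dist_norm)
qed

lemma has_vector_derivative_circle:
  "(circle p r has_vector_derivative r *\<^sub>R vector [- sin t, cos t]) (at t within S)"
proof -
  have *: "circle p r = (\<lambda>t. p + (r * cos t) *\<^sub>R axis 1 1 + (r * sin t) *\<^sub>R axis 2 1)"
    by (rule ext) (simp add: vec2_eq_iff axis_def)
  have "((\<lambda>t. p + (r * cos t) *\<^sub>R axis 1 1 + (r * sin t) *\<^sub>R axis 2 1)
     has_vector_derivative (r * (- sin t)) *\<^sub>R axis 1 1 + (r * cos t) *\<^sub>R axis 2 1) (at t within S)"
    by (auto intro!: derivative_eq_intros simp: has_real_derivative_iff_has_vector_derivative [symmetric]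
        mult.commute)
  moreover have "r *\<^sub>R vector [- sin t, cos t] =
      (r * (- sin t)) *\<^sub>R (axis 1 1 :: real^2) + (r * cos t) *\<^sub>R axis 2 1"
    by (simp add: vec2_eq_iff axis_def)
  ultimately show ?thesis by (simp only: *)
qed

text \<open>The form \<open>\<omega>\<^sub>W\<close> along a curve is the imaginary part of the logarithmic derivative, so \<open>Im L\<close> along
  the circle is a primitive of the integrand.\<close>

lemma has_integral_omega_W_circle:
  assumes diff: "\<And>t. t \<in> {\<alpha>..\<beta>} \<Longrightarrow> F differentiable at (circle p r t)"
    and le: "\<alpha> \<le> \<beta>" and K: "\<And>t. t \<in> {\<alpha>..\<beta>} \<Longrightarrow> circle p r t \<in> K"
    and L: "continuous_on K L" "\<And>x. x \<in> K \<Longrightarrow> cplx (F x) = exp (L x)"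
  shows "((\<lambda>t. omega_W (F (circle p r t)) (vector_derivative (\<lambda>s. F (circle p r s)) (at t)))
     has_integral Im (L (circle p r \<beta>)) - Im (L (circle p r \<alpha>))) {\<alpha>..\<beta>}"
proof (rule fundamental_theorem_of_calculus [OF le])
  fix t assume t: "t \<in> {\<alpha>..\<beta>}"
  define v where "v = vector_derivative (\<lambda>s. F (circle p r s)) (at t)"
  from diff [OF t] obtain F' where "(F has_derivative F') (at (circle p r t))"
    by (auto simp: differentiable_def)
  from vector_derivative_diff_chain_within [OF has_vector_derivative_circle [where S = UNIV]
      has_derivative_at_withinI [OF this]]
  have "((\<lambda>s. F (circle p r s)) has_vector_derivative v) (at t)"
    unfolding v_def o_def by (auto simp: vector_derivative_works [symmetric] differentiableI_vector)
  then have "((\<lambda>s. cplx (F (circle p r s))) has_vector_derivative cplx v) (at t within {\<alpha>..\<beta>})"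
    by (intro bounded_linear.has_vector_derivative [OF bounded_linear_cplx])
      (rule has_vector_derivative_at_within)
  moreover have "continuous_on {\<alpha>..\<beta>} (\<lambda>t. L (circle p r t))"
  proof (rule continuous_on_compose2 [OF L(1)])
    show "continuous_on {\<alpha>..\<beta>} (circle p r)"
      by (meson has_vector_derivative_circle has_vector_derivative_continuous
          continuous_on_eq_continuous_within)
  qed (use K in auto)
  ultimately have "((\<lambda>t. L (circle p r t)) has_vector_derivative cplx v / cplx (F (circle p r t)))
      (at t within {\<alpha>..\<beta>})"
    by (intro has_vector_derivative_continuous_log [OF _ t]) (use L K in auto)
  from bounded_linear.has_vector_derivative [OF bounded_linear_Im this]
  show "((\<lambda>t. Im (L (circle p r t))) has_vector_derivative omega_W (F (circle p r t)) v)
      (at t within {\<alpha>..\<beta>})"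
    by (simp add: omega_W_eq_Im)
qed

text \<open>The sign of \<open>\<sigma>\<close> selects the upper or the lower half disc; either is convex, hence contractible.\<close>

lemma continuous_log_half_disc:
  fixes F :: "real^2 \<Rightarrow> real^2" and \<sigma> :: real
  assumes "\<And>x. x \<in> cball p r \<Longrightarrow> F differentiable at x"
    and "\<And>x. x \<in> cball p r \<Longrightarrow> 0 \<le> \<sigma> * x $ 2 \<Longrightarrow> F x \<noteq> 0"
  obtains L where "continuous_on {x \<in> cball p r. 0 \<le> \<sigma> * x $ 2} L"
    "\<And>x. x \<in> {x \<in> cball p r. 0 \<le> \<sigma> * x $ 2} \<Longrightarrow> cplx (F x) = exp (L x)"
proof -
  let ?K = "{x \<in> cball p r. 0 \<le> \<sigma> * x $ 2}"
  have "?K = cball p r \<inter> {x. axis 2 \<sigma> \<bullet> x \<ge> 0}"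
    by (auto simp: inner_axis' mult.commute)
  then have "convex ?K"
    by (simp only:) (intro convex_Int convex_cball convex_halfspace_ge)
  then have "contractible ?K" by (rule convex_imp_contractible)
  moreover have "continuous_on ?K (\<lambda>x. cplx (F x))"
    using assms(1) differentiable_imp_continuous_within
    by (intro bounded_linear.continuous_on [OF bounded_linear_cplx] continuous_at_imp_continuous_on)
      blast
  moreover have "cplx (F x) \<noteq> 0" if "x \<in> ?K" for x
    using that assms(2) by simp
  ultimately obtain L where "continuous_on ?K L" "\<And>x. x \<in> ?K \<Longrightarrow> cplx (F x) = exp (L x)"
    using continuous_logarithm_on_contractible [of ?K "\<lambda>x. cplx (F x)"] by blast
  then show ?thesis by (rule that)
qed

text \<open>The parameters whose circle points lie in a closed half disc form a half period together with the
  parameters \<open>0\<close> and \<open>2\<pi>\<close>, which both give the right endpoint of the diameter; the stray points are a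
  null set. The domain \<open>K\<close> of the logarithm is kept apart from \<open>S\<close>, which may extend far beyond
  the disc.\<close>

lemma arc_integral_half:
  assumes "r > 0"
    and "\<And>x. x \<in> cball p r \<Longrightarrow> F differentiable at x"
    and "\<alpha> \<in> {0, pi}"
    and S: "\<And>t. circle p r t \<in> S \<longleftrightarrow> circle p r t \<in> K"
    and K: "\<And>t. t \<in> {0..2*pi} \<Longrightarrow> circle p r t \<in> K \<longleftrightarrow> t \<in> {\<alpha>..\<alpha>+pi} \<union> {0, 2*pi}"
    and L: "continuous_on K L" "\<And>x. x \<in> K \<Longrightarrow> cplx (F x) = exp (L x)"
  shows "arc_integral F S p r = Im (L (circle p r (\<alpha> + pi))) - Im (L (circle p r \<alpha>))"
proof -
  let ?f = "\<lambda>t. omega_W (F (circle p r t)) (vector_derivative (\<lambda>s. F (circle p r s)) (at t))"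
  have sub: "{\<alpha>..\<alpha>+pi} \<subseteq> {0..2*pi}" using assms(3) by auto
  have set_eq: "{t \<in> {0..2*pi}. circle p r t \<in> S} = {\<alpha>..\<alpha>+pi} \<union> {0, 2*pi}"
  proof -
    have "{t \<in> {0..2*pi}. circle p r t \<in> S} = {t \<in> {0..2*pi}. t \<in> {\<alpha>..\<alpha>+pi} \<union> {0, 2*pi}}"
      unfolding S using K by blast
    moreover have "{0, 2*pi} \<subseteq> {0..2*pi}" by simp
    ultimately show ?thesis using sub by blast
  qed
  have "integral {t \<in> {0..2*pi}. circle p r t \<in> S} ?f = integral {\<alpha>..\<alpha>+pi} ?f"
    unfolding set_eq
    by (rule integral_subset_negligible [symmetric], blast)
      (rule negligible_subset [of "{0, 2*pi}"], simp, blast)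
  also have "\<dots> = Im (L (circle p r (\<alpha> + pi))) - Im (L (circle p r \<alpha>))"
  proof (intro integral_unique has_integral_omega_W_circle)
    show "F differentiable at (circle p r t)" for t
      using assms(1,2) circle_in_cball by simp
    show "circle p r t \<in> K" if "t \<in> {\<alpha>..\<alpha>+pi}" for t
      using that K sub by blast
  qed (use L in auto)
  finally show ?thesis by (simp add: arc_integral_def)
qed

section \<open>Lie derivatives on the switching line\<close>

lemma C1_on_imp_differentiable: "C1_on g S \<Longrightarrow> x \<in> S \<Longrightarrow> g differentiable at x"
  by (auto simp: C1_on_def differentiable_def)

lemma C2_on_imp_differentiable: "C2_on g S \<Longrightarrow> x \<in> S \<Longrightarrow> g differentiable at x"
  by (auto simp: C2_on_def differentiable_def)

lemma has_real_derivative_compose: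
  fixes g :: "'a::real_normed_vector \<Rightarrow> real" and c :: "real \<Rightarrow> 'a"
  assumes "(c has_vector_derivative v) (at t)" "g differentiable at (c t)"
  shows "((\<lambda>s. g (c s)) has_real_derivative frechet_derivative g (at (c t)) v) (at t)"
  using vector_derivative_diff_chain_within [where S = UNIV, OF assms(1)
      has_derivative_at_withinI [OF frechet_derivative_works [THEN iffD1, OF assms(2)]]]
  by (simp add: o_def has_real_derivative_iff_has_vector_derivative)

lemma lie_deriv_eq_frechet:
  assumes "g differentiable at x"
  shows "lie_deriv F g x = frechet_derivative g (at x) (F x)"
proof -
  interpret linear "frechet_derivative g (at x)"
    using assms by (rule linear_frechet_derivative)
  have "frechet_derivative g (at x) (F x) =
      frechet_derivative g (at x) (F x $ 1 *\<^sub>R axis 1 1 + F x $ 2 *\<^sub>R axis 2 1)"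
    using vec2_decomp [of "F x"] by simp
  also have "\<dots> = F x $ 1 * frechet_derivative g (at x) (axis 1 1)
      + F x $ 2 * frechet_derivative g (at x) (axis 2 1)"
    by (simp add: add scale)
  finally show ?thesis by (simp add: lie_deriv_def grad_def inner_vec2 mult.commute)
qed

text \<open>On \<open>S\<close> the Lie derivative is the derivative of \<open>g\<close> evaluated at \<open>F\<close>, a bilinear
  expression in two differentiable maps.\<close>

lemma lie_deriv_differentiable:
  assumes "open S" "C2_on g S" "C1_on F S" "x \<in> S"
  shows "lie_deriv F g differentiable at x"
proof -
  obtain g' :: "real^2 \<Rightarrow> (real^2) \<Rightarrow>\<^sub>L real" where
    g': "\<And>x. x \<in> S \<Longrightarrow> (g has_derivative blinfun_apply (g' x)) (at x)" "C1_on g' S"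
    using assms(2) by (auto simp: C2_on_def)
  obtain G F' where "(g' has_derivative G) (at x)" "(F has_derivative F') (at x)"
    using C1_on_imp_differentiable [OF g'(2)] C1_on_imp_differentiable [OF assms(3)] assms(4)
    unfolding differentiable_def by blast
  then have "((\<lambda>y. blinfun_apply (g' y) (F y)) has_derivative
      (\<lambda>h. blinfun_apply (g' x) (F' h) + blinfun_apply (G h) (F x))) (at x)"
    by (rule blinfun.FDERIV)
  then have "(lie_deriv F g has_derivative
      (\<lambda>h. blinfun_apply (g' x) (F' h) + blinfun_apply (G h) (F x))) (at x)"
  proof (rule has_derivative_transform_within_open [OF _ assms(1,4)])
    fix y assume "y \<in> S"
    then show "blinfun_apply (g' y) (F y) = lie_deriv F g y"
      using g'(1) lie_deriv_eq_frechet frechet_derivative_at by (metis differentiableI)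
  qed
  then show ?thesis by (auto simp: differentiable_def)
qed

lemma
  assumes "planar_filippov Z" "x \<in> region Z"
  shows switch_differentiable: "switch Z differentiable at x"
    and Fplus_differentiable: "Fplus Z differentiable at x"
    and Fminus_differentiable: "Fminus Z differentiable at x"
  using assms C1_on_imp_differentiable C2_on_imp_differentiable
  unfolding planar_filippov_def by blast+

lemma Sigma_iff:
  assumes "planar_filippov Z"
  shows "x \<in> Sigma0 Z \<longleftrightarrow> x \<in> region Z \<and> x $ 2 = 0"
    and "x \<in> Sigma_plus Z \<longleftrightarrow> x \<in> region Z \<and> x $ 2 \<ge> 0"
    and "x \<in> Sigma_minus Z \<longleftrightarrow> x \<in> region Z \<and> x $ 2 \<le> 0"
  using assms unfolding planar_filippov_def Sigma0_def Sigma_plus_def Sigma_minus_def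
  by (smt (verit, ccfv_SIG) mem_Collect_eq)+

lemma eventually_line_in_open:
  fixes x v :: "'a::real_normed_vector"
  assumes "open S" "x \<in> S"
  shows "\<forall>\<^sub>F s in nhds 0. x + s *\<^sub>R v \<in> S"
proof -
  have "((\<lambda>s. x + s *\<^sub>R v) \<longlongrightarrow> x + 0 *\<^sub>R v) (nhds 0)"
    by (intro tendsto_intros filterlim_ident)
  then show ?thesis using assms topological_tendstoD by fastforce
qed

text \<open>Along \<open>\<Sigma>\<close> the switching function is constant, and above \<open>\<Sigma>\<close> it is positive; so its gradient,
  which does not vanish, points straight up. Thus Lie derivatives on \<open>\<Sigma>\<close> have the signs of the
  second components of the fields, whatever the switching function is.\<close>

lemma grad_switch_on_Sigma:
  assumes Z: "planar_filippov Z" and x: "x \<in> Sigma0 Z"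
  shows "grad (switch Z) x $ 1 = 0" "grad (switch Z) x $ 2 > 0"
proof -
  have x': "x \<in> region Z" "x $ 2 = 0" "open (region Z)"
    and sw: "\<And>y. y \<in> region Z \<Longrightarrow> switch Z y = 0 \<longleftrightarrow> y $ 2 = 0"
    "\<And>y. y \<in> region Z \<Longrightarrow> y $ 2 > 0 \<Longrightarrow> switch Z y > 0"
    and "grad (switch Z) x \<noteq> 0"
    using Z x Sigma_iff [OF Z] unfolding planar_filippov_def Sigma0_def by auto
  have der: "((\<lambda>s. switch Z (x + s *\<^sub>R axis i 1)) has_real_derivative grad (switch Z) x $ i) (at 0)" for i
  proof -
    have "((\<lambda>s. x + s *\<^sub>R axis i 1) has_vector_derivative axis i 1) (at 0)"
      by (auto intro!: derivative_eq_intros)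
    from has_real_derivative_compose [OF this, of "switch Z"] switch_differentiable [OF Z x'(1)]
    show ?thesis by (simp add: grad_def)
  qed
  have ax: "(axis 1 1 :: real^2) $ 2 = 0" "(axis 2 1 :: real^2) $ 2 = 1"
    by (simp_all add: axis_def)
  have "\<forall>\<^sub>F s in nhds 0. switch Z (x + s *\<^sub>R axis 1 1) = 0"
    using eventually_line_in_open [OF x'(3,1), of "axis 1 1"]
    by eventually_elim (simp add: sw x' ax)
  from DERIV_cong_ev [OF refl this refl, of "grad (switch Z) x $ 1"] der [of 1]
  show 1: "grad (switch Z) x $ 1 = 0"
    using DERIV_unique [OF _ DERIV_const] by blast
  have "grad (switch Z) x $ 2 \<ge> 0"
  proof (rule ccontr)
    assume "\<not> ?thesis"
    then obtain d where "d > 0" and d: "\<And>h. 0 < h \<Longrightarrow> h < d \<Longrightarrow> switch Z (x + h *\<^sub>R axis 2 1) < 0"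
      using DERIV_neg_dec_right [OF der [of 2]] sw(1) [OF x'(1)] x'(2) by auto
    obtain e where "e > 0" and e: "\<And>h. dist h 0 < e \<Longrightarrow> x + h *\<^sub>R axis 2 1 \<in> region Z"
      using eventually_line_in_open [OF x'(3,1), of "axis 2 1"] unfolding eventually_nhds_metric by blast
    define h where "h = min d e / 2"
    have "0 < h" "h < d" "dist h 0 < e" using \<open>d > 0\<close> \<open>e > 0\<close> by (auto simp: h_def)
    with d [of h] e [of h] sw(2) [of "x + h *\<^sub>R axis 2 1"] x'(2) show False
      by (simp add: ax)
  qed
  with 1 \<open>grad (switch Z) x \<noteq> 0\<close> show "grad (switch Z) x $ 2 > 0"
    by (auto simp: vec2_eq_iff)
qed

lemma lie_deriv_on_Sigma:
  assumes "planar_filippov Z" "x \<in> Sigma0 Z"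
  shows "lie_deriv F (switch Z) x = grad (switch Z) x $ 2 * F x $ 2"
  using grad_switch_on_Sigma [OF assms] by (simp add: lie_deriv_def inner_vec2)

section \<open>The index as a difference of winding counts\<close>

text \<open>If \<open>F\<^sup>+ = -c F\<^sup>-\<close> with \<open>c > 0\<close> at a point of \<open>\<Sigma>\<close> where neither field is tangent to \<open>\<Sigma>\<close>, then the
  Lie derivatives have opposite signs and the sliding field vanishes: a pseudo-equilibrium. Quotients
  by \<open>0\<close> are \<open>0\<close>, so the hypothesis also covers zeros of either field.\<close>

lemma nonpos_ratio_imp_singularity:
  assumes Z: "planar_filippov Z" and x: "x \<in> Sigma0 Z"
    and ratio: "cplx (Fplus Z x) / cplx (Fminus Z x) \<in> \<real>\<^sub>\<le>\<^sub>0"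
  shows "singularity Z x"
proof (cases "Fplus Z x = 0 \<or> Fminus Z x = 0 \<or> tangential_singularity Z x")
  case True
  moreover have "x \<in> Sigma_plus Z" "x \<in> Sigma_minus Z"
    using x Sigma_iff [OF Z] by auto
  ultimately show ?thesis by (auto simp: singularity_def)
next
  case False
  obtain c where c: "c \<ge> 0" "cplx (Fplus Z x) / cplx (Fminus Z x) = - of_real c"
    using ratio by (metis nonpos_Reals_cases of_real_minus minus_minus neg_0_le_iff_le)
  then have "cplx (Fplus Z x) = - of_real c * cplx (Fminus Z x)"
    using False by (simp add: divide_eq_eq)
  then have eq: "Fplus Z x = (- c) *\<^sub>R Fminus Z x"
    by (simp add: complex_eq_iff vec2_eq_iff)
  then have L: "Lplus Z x = - c * Lminus Z x"
    by (simp add: lie_deriv_def)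
  have nz: "Lplus Z x \<noteq> 0" "Lminus Z x \<noteq> 0"
    using False x by (auto simp: tangential_singularity_def)
  with L c(1) have "c > 0" by (cases "c = 0") auto
  with L nz x have "x \<in> sliding_region Z \<union> escaping_region Z"
    by (auto simp: sliding_region_def escaping_region_def zero_less_mult_iff mult_less_0_iff)
  moreover have "sliding_field Z x = 0"
    by (simp add: sliding_field_def eq L)
  ultimately show ?thesis by (simp add: singularity_def pseudo_equilibrium_def)
qed

lemma circle_on_xaxis:
  assumes "p $ 2 = 0"
  shows "circle p r 0 = xaxis (p $ 1 + r)" "circle p r pi = xaxis (p $ 1 - r)"
    "circle p r (2 * pi) = xaxis (p $ 1 + r)"
  using assms by (simp_all add: vec2_eq_iff)

lemma xaxis_in_cball:
  assumes "p $ 2 = 0"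
  shows "xaxis s \<in> cball p r \<longleftrightarrow> s \<in> {p $ 1 - r..p $ 1 + r}"
  using dist_xaxis [of "p $ 1" s] xaxis_of_nth [OF assms] by (auto simp: mem_cball)

text \<open>\<open>\<Phi>\<close> is the difference of the logarithms of the two fields along the diameter. In the sum of the two
  arc integrals its imaginary part appears at the endpoints with the signs opposite to the jump terms,
  and replacing a lifted angle by its principal value leaves only the number of full turns.\<close>

lemma circle_index_eq_floor_diff:
  fixes Z :: filippov and p :: "real^2"
  assumes Z: "planar_filippov Z" and p: "p \<in> Sigma0 Z"
    and iso: "isolating_radius Z p r"
    and nz: "Fplus Z p \<noteq> 0" "Fminus Z p \<noteq> 0"
  obtains \<Phi> :: "real \<Rightarrow> complex" where "continuous_on {p $ 1 - r..p $ 1 + r} \<Phi>"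
    "\<And>s. s \<in> {p $ 1 - r..p $ 1 + r} \<Longrightarrow> cplx (Fplus Z (xaxis s)) / cplx (Fminus Z (xaxis s)) = exp (\<Phi> s)"
    "circle_index Z p r = of_int (\<lfloor>(Im (\<Phi> (p $ 1 - r)) + pi) / (2 * pi)\<rfloor>
       - \<lfloor>(Im (\<Phi> (p $ 1 + r)) + pi) / (2 * pi)\<rfloor>)"
proof -
  let ?a = "p $ 1"
  have r: "r > 0" and sub: "cball p r \<subseteq> region Z" and uniq: "{x \<in> cball p r. singularity Z x} = {p}"
    using iso by (auto simp: isolating_radius_def)
  have p2: "p $ 2 = 0" using p Sigma_iff [OF Z] by simp
  have sing: "\<not> singularity Z x" if "x \<in> cball p r" "x \<noteq> p" for x
    using uniq that by blast
  have diff: "Fplus Z differentiable at x" "Fminus Z differentiable at x" if "x \<in> cball p r" for x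
    using that sub Fplus_differentiable [OF Z] Fminus_differentiable [OF Z] by blast+
  let ?Kp = "{x \<in> cball p r. 0 \<le> 1 * x $ 2}" and ?Km = "{x \<in> cball p r. 0 \<le> -1 * x $ 2}"
  have "Fplus Z x \<noteq> 0" if "x \<in> cball p r" "0 \<le> 1 * x $ 2" for x
    using that sing [of x] nz sub Sigma_iff(2) [OF Z, of x] by (auto simp: singularity_def)
  then obtain L where L: "continuous_on ?Kp L" "\<And>x. x \<in> ?Kp \<Longrightarrow> cplx (Fplus Z x) = exp (L x)"
    using continuous_log_half_disc [OF diff(1), where \<sigma> = 1] by blast
  have "Fminus Z x \<noteq> 0" if "x \<in> cball p r" "0 \<le> -1 * x $ 2" for x
    using that sing [of x] nz sub Sigma_iff(3) [OF Z, of x] by (auto simp: singularity_def)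
  then obtain M where M: "continuous_on ?Km M" "\<And>x. x \<in> ?Km \<Longrightarrow> cplx (Fminus Z x) = exp (M x)"
    using continuous_log_half_disc [OF diff(2), where \<sigma> = "-1"] by blast
  define \<Phi> where "\<Phi> s = L (xaxis s) - M (xaxis s)" for s
  have axis: "xaxis s \<in> ?Kp" "xaxis s \<in> ?Km" if "s \<in> {p $ 1 - r..p $ 1 + r}" for s
    using that by (auto simp: xaxis_in_cball [OF p2] simp del: mem_cball)
  have cont: "continuous_on {p $ 1 - r..p $ 1 + r} \<Phi>" unfolding \<Phi>_def
    using axis
    by (intro continuous_on_diff continuous_on_compose2 [OF L(1) continuous_on_xaxis]
        continuous_on_compose2 [OF M(1) continuous_on_xaxis]) blast+
  have ratio: "cplx (Fplus Z (xaxis s)) / cplx (Fminus Z (xaxis s)) = exp (\<Phi> s)" if "s \<in> {p $ 1 - r..p $ 1 + r}" for s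
    using L(2) M(2) axis [OF that] by (simp add: \<Phi>_def exp_diff)
  have in_cball: "circle p r t \<in> cball p r" for t using r circle_in_cball by simp
  have sin_pos: "0 \<le> sin t \<longleftrightarrow> t \<in> {0..pi} \<union> {0, 2 * pi}" if "t \<in> {0..2*pi}" for t
    using that sin_ge_zero [of t] sin_lt_zero [of t] by force
  have sin_neg: "sin t \<le> 0 \<longleftrightarrow> t \<in> {pi..pi + pi} \<union> {0, 2 * pi}" if "t \<in> {0..2*pi}" for t
    using that sin_gt_zero [of t] sin_le_zero [of t] by force
  have "arc_integral (Fplus Z) (Sigma_plus Z) p r = Im (L (circle p r (0 + pi))) - Im (L (circle p r 0))"
  proof (rule arc_integral_half [OF r diff(1) _ _ _ L])
    show "circle p r t \<in> Sigma_plus Z \<longleftrightarrow> circle p r t \<in> ?Kp" for t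
      using in_cball sub Sigma_iff(2) [OF Z] by auto
    show "circle p r t \<in> ?Kp \<longleftrightarrow> t \<in> {0..0 + pi} \<union> {0, 2 * pi}" if "t \<in> {0..2*pi}" for t
      using sin_pos [OF that] in_cball [of t] p2 r by (simp add: zero_le_mult_iff)
  qed auto
  then have arc_plus: "arc_integral (Fplus Z) (Sigma_plus Z) p r
      = Im (L (xaxis (?a - r))) - Im (L (xaxis (?a + r)))"
    using circle_on_xaxis [OF p2] by simp
  have "arc_integral (Fminus Z) (Sigma_minus Z) p r = Im (M (circle p r (pi + pi))) - Im (M (circle p r pi))"
  proof (rule arc_integral_half [OF r diff(2) _ _ _ M])
    show "circle p r t \<in> Sigma_minus Z \<longleftrightarrow> circle p r t \<in> ?Km" for t
      using in_cball sub Sigma_iff(3) [OF Z] by auto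
    show "circle p r t \<in> ?Km \<longleftrightarrow> t \<in> {pi..pi + pi} \<union> {0, 2 * pi}" if "t \<in> {0..2*pi}" for t
      using sin_neg [OF that] in_cball [of t] p2 r by (simp add: mult_le_0_iff)
  qed auto
  then have arc_minus: "arc_integral (Fminus Z) (Sigma_minus Z) p r
      = Im (M (xaxis (?a + r))) - Im (M (xaxis (?a - r)))"
    using circle_on_xaxis [OF p2] by (simp add: mult_2 [symmetric])
  have jump: "J_jump Z (xaxis s) = Im (\<Phi> s) - 2 * pi * of_int \<lfloor>(Im (\<Phi> s) + pi) / (2 * pi)\<rfloor>"
    if s: "s \<in> {p $ 1 - r..p $ 1 + r}" "s \<noteq> ?a" for s
  proof -
    have "xaxis s \<in> cball p r" "xaxis s \<noteq> p"
      using axis [OF s(1)] s(2) xaxis_nth(1) [of s] by auto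
    then have "exp (\<Phi> s) \<notin> \<real>\<^sub>\<le>\<^sub>0"
      using nonpos_ratio_imp_singularity [OF Z, of "xaxis s"] sing ratio [OF s(1)] sub
      by (auto simp: Sigma_iff [OF Z])
    then show ?thesis
      using J_jump_eq_Arg [of Z "xaxis s"] Arg_exp_eq exp_in_nonpos_Reals ratio [OF s(1)] by metis
  qed
  define k where "k s = \<lfloor>(Im (\<Phi> s) + pi) / (2 * pi)\<rfloor>" for s
  have "J_plus Z p r = J_jump Z (xaxis (?a + r))" "J_minus Z p r = - J_jump Z (xaxis (?a - r))"
    using p2 r by (simp_all add: J_plus_def J_minus_def xaxis_def)
  moreover have "J_jump Z (xaxis (?a + r)) = Im (\<Phi> (?a + r)) - 2 * pi * of_int (k (?a + r))"
    "J_jump Z (xaxis (?a - r)) = Im (\<Phi> (?a - r)) - 2 * pi * of_int (k (?a - r))"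
    unfolding k_def using r by (intro jump; simp)+
  ultimately have "J_plus Z p r + J_minus Z p r + arc_integral (Fplus Z) (Sigma_plus Z) p r
      + arc_integral (Fminus Z) (Sigma_minus Z) p r = 2 * pi * of_int (k (?a - r) - k (?a + r))"
    unfolding arc_plus arc_minus by (simp add: \<Phi>_def algebra_simps)
  then have "circle_index Z p r = of_int (k (?a - r) - k (?a + r))"
    by (simp add: circle_index_def)
  with cont ratio show ?thesis unfolding k_def by (rule that)
qed

section \<open>Sliding field and isolation of the singularity\<close>

lemma differentiable_along_xaxis:
  fixes F :: "real^2 \<Rightarrow> real^2"
  assumes "F differentiable at (xaxis s)"
  obtains d where "((\<lambda>s. F (xaxis s) $ i) has_real_derivative d) (at s)"
proof -
  obtain F' where "(F has_derivative F') (at (xaxis s))"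
    using assms by (auto simp: differentiable_def)
  from bounded_linear.has_derivative [OF bounded_linear_vec_nth this]
  have "(\<lambda>x. F x $ i) differentiable at (xaxis s)" by (auto simp: differentiable_def)
  from has_real_derivative_compose [OF has_vector_derivative_xaxis this] show ?thesis
    by (rule that)
qed

lemma isCont_along_xaxis:
  fixes F :: "real^2 \<Rightarrow> real^2"
  assumes "F differentiable at (xaxis s)"
  shows "isCont (\<lambda>s. F (xaxis s) $ i) s"
  using differentiable_along_xaxis [OF assms] DERIV_isCont by metis

lemma eventually_nonzero_along_xaxis:
  fixes F :: "real^2 \<Rightarrow> real^2"
  assumes "F differentiable at (xaxis a)" "F (xaxis a) $ i \<noteq> 0"
  shows "\<forall>\<^sub>F s in at a. F (xaxis s) $ i \<noteq> 0"
  using isCont_along_xaxis [OF assms(1), of i] assms(2) tendsto_imp_eventually_ne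
  by (auto simp: isCont_def)

lemma differentiable_cross_along_xaxis:
  fixes F G :: "real^2 \<Rightarrow> real^2"
  assumes "F differentiable at (xaxis s)" "G differentiable at (xaxis s)"
  obtains d where "((\<lambda>s. cross (F (xaxis s)) (G (xaxis s))) has_real_derivative d) (at s)"
proof -
  obtain f1 f2 g1 g2 where
    "((\<lambda>s. F (xaxis s) $ 1) has_real_derivative f1) (at s)"
    "((\<lambda>s. F (xaxis s) $ 2) has_real_derivative f2) (at s)"
    "((\<lambda>s. G (xaxis s) $ 1) has_real_derivative g1) (at s)"
    "((\<lambda>s. G (xaxis s) $ 2) has_real_derivative g2) (at s)"
    using differentiable_along_xaxis [OF assms(1)] differentiable_along_xaxis [OF assms(2)] by metis
  then have "((\<lambda>s. cross (F (xaxis s)) (G (xaxis s))) has_real_derivative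
      (f1 * G (xaxis s) $ 2 + g2 * F (xaxis s) $ 1) - (g1 * F (xaxis s) $ 2 + f2 * G (xaxis s) $ 1)) (at s)"
    unfolding cross_def by (intro DERIV_diff DERIV_mult)
  then show ?thesis by (rule that)
qed

lemma eventually_nonzero_of_deriv_nonzero:
  fixes g :: "real \<Rightarrow> real"
  assumes "(g has_real_derivative d) (at a)" "d \<noteq> 0" "g a = 0"
  shows "\<forall>\<^sub>F s in at a. g s \<noteq> 0"
proof -
  have "((\<lambda>s. (g s - g a) / (s - a)) \<longlongrightarrow> d) (at a)"
    using assms(1) by (simp add: has_field_derivative_iff)
  from tendsto_imp_eventually_ne [OF this assms(2)] show ?thesis
    by eventually_elim (use assms(3) in auto)
qed

lemma same_sign_of_nonvanishing:
  fixes g :: "real \<Rightarrow> real"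
  assumes "continuous_on {a..b} g" "\<And>s. s \<in> {a..b} \<Longrightarrow> g s \<noteq> 0"
    and "s \<in> {a..b}" "t \<in> {a..b}" "g s < 0"
  shows "g t < 0"
proof (rule ccontr)
  assume "\<not> g t < 0"
  moreover have "connected (g ` {a..b})"
    using assms(1) by (intro connected_continuous_image connected_Icc)
  ultimately have "0 \<in> g ` {a..b}"
    using assms(3-5) connected_contains_Icc [of "g ` {a..b}" "g s" "g t"] by auto
  then show False using assms(2) by auto
qed

text \<open>The derivative decides the signs next to \<open>a\<close>, and these persist as long as there are no
  further zeros.\<close>

lemma sign_at_endpoints:
  fixes g :: "real \<Rightarrow> real"
  assumes "r > 0" and cont: "continuous_on {a-r..a+r} g"
    and nz: "\<And>s. s \<in> {a-r..a+r} \<Longrightarrow> s \<noteq> a \<Longrightarrow> g s \<noteq> 0"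
    and der: "(g has_real_derivative d) (at a)" "d < 0" and "g a = 0"
  shows "g (a - r) > 0" "g (a + r) < 0"
proof -
  obtain e where e: "e > 0" "\<And>h. 0 < h \<Longrightarrow> h < e \<Longrightarrow> g (a - h) > 0"
    using DERIV_neg_dec_left [OF der] \<open>g a = 0\<close> by auto
  obtain e' where e': "e' > 0" "\<And>h. 0 < h \<Longrightarrow> h < e' \<Longrightarrow> g (a + h) < 0"
    using DERIV_neg_dec_right [OF der] \<open>g a = 0\<close> by auto
  define h where "h = min r (min e e') / 2"
  have h: "0 < h" "h < r" "h < e" "h < e'"
    using \<open>r > 0\<close> e(1) e'(1) by (auto simp: h_def)
  have "continuous_on {a+h..a+r} g" "continuous_on {a-r..a-h} g"
    using cont by (rule continuous_on_subset; use h in auto)+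
  then show "g (a + r) < 0" "g (a - r) > 0"
    using same_sign_of_nonvanishing [of "a+h" "a+r" g "a+h" "a+r"]
      same_sign_of_nonvanishing [of "a-r" "a-h" "\<lambda>s. - g s" "a-h" "a-r"]
      e(2) [OF h(1,3)] e'(2) [OF h(1,4)] nz h by (auto intro: continuous_on_minus)
qed

text \<open>The vertical component of the gradient of the switching function cancels.\<close>

lemma sliding_field_on_Sigma:
  assumes "planar_filippov Z" "x \<in> Sigma0 Z"
  shows "sliding_field Z x $ 1
    = cross (Fplus Z x) (Fminus Z x) / (Fminus Z x $ 2 - Fplus Z x $ 2)"
proof -
  define g where "g = grad (switch Z) x $ 2"
  have g: "g \<noteq> 0" using grad_switch_on_Sigma [OF assms] by (simp add: g_def)
  have "sliding_field Z x $ 1 = (g * cross (Fplus Z x) (Fminus Z x)) / (g * (Fminus Z x $ 2 - Fplus Z x $ 2))"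
    by (simp add: sliding_field_def lie_deriv_on_Sigma [OF assms] g_def cross_def diff_divide_distrib
        algebra_simps)
  then show ?thesis using g by simp
qed

lemma sliding_or_escaping_imp:
  assumes "planar_filippov Z"
  shows "x \<in> sliding_region Z \<Longrightarrow> Fplus Z x $ 2 < 0 \<and> 0 < Fminus Z x $ 2"
    and "x \<in> escaping_region Z \<Longrightarrow> 0 < Fplus Z x $ 2 \<and> Fminus Z x $ 2 < 0"
  using grad_switch_on_Sigma [OF assms, of x] lie_deriv_on_Sigma [OF assms, of x]
  by (auto simp: sliding_region_def escaping_region_def mult_less_0_iff zero_less_mult_iff)

text \<open>Zeros of the fields are excluded near \<open>p\<close> by continuity, in the full plane. The other singularities
  lie on \<open>\<Sigma>\<close>, where the conditions along the axis exclude tangencies and, through the determinant,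
  pseudo-equilibria. The conditions are imposed off \<open>p\<close> only, because at a fold one of the components
  vanishes at \<open>p\<close>, and at a pseudo-equilibrium the determinant does.\<close>

lemma isolating_radius_exists:
  assumes Z: "planar_filippov Z" and p: "p \<in> Sigma0 Z" "singularity Z p"
    and nz: "Fplus Z p \<noteq> 0" "Fminus Z p \<noteq> 0"
    and axis: "\<forall>\<^sub>F s in at (p $ 1). Fplus Z (xaxis s) $ 2 \<noteq> 0 \<and> Fminus Z (xaxis s) $ 2 \<noteq> 0
      \<and> cross (Fplus Z (xaxis s)) (Fminus Z (xaxis s)) \<noteq> 0"
  shows "\<exists>r. isolating_radius Z p r"
proof -
  have p': "p \<in> region Z" "p $ 2 = 0" "open (region Z)"
    using p Sigma_iff [OF Z] Z by (auto simp: planar_filippov_def)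
  have "isCont (Fplus Z) p" "isCont (Fminus Z) p"
    using Fplus_differentiable [OF Z p'(1)] Fminus_differentiable [OF Z p'(1)]
    by (auto intro: differentiable_imp_continuous_within)
  then have "\<forall>\<^sub>F x in nhds p. Fplus Z x \<noteq> 0" "\<forall>\<^sub>F x in nhds p. Fminus Z x \<noteq> 0"
    using nz tendsto_imp_eventually_ne by (auto simp: isCont_def tendsto_at_iff_tendsto_nhds)
  moreover have "\<forall>\<^sub>F x in nhds p. x \<in> region Z"
    using p' eventually_nhds by blast
  ultimately have "\<forall>\<^sub>F x in nhds p. x \<in> region Z \<and> Fplus Z x \<noteq> 0 \<and> Fminus Z x \<noteq> 0"
    by eventually_elim simp
  then obtain e1 where e1: "e1 > 0"
    "\<And>x. dist x p < e1 \<Longrightarrow> x \<in> region Z \<and> Fplus Z x \<noteq> 0 \<and> Fminus Z x \<noteq> 0"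
    unfolding eventually_nhds_metric by blast
  obtain e2 where e2: "e2 > 0"
    "\<And>s. s \<noteq> p $ 1 \<Longrightarrow> dist s (p $ 1) < e2 \<Longrightarrow> Fplus Z (xaxis s) $ 2 \<noteq> 0 \<and> Fminus Z (xaxis s) $ 2 \<noteq> 0
      \<and> cross (Fplus Z (xaxis s)) (Fminus Z (xaxis s)) \<noteq> 0"
    using axis unfolding eventually_at by blast
  define r where "r = min e1 e2 / 2"
  have r: "r > 0" "r < e1" "r < e2" using e1(1) e2(1) by (auto simp: r_def)
  have "\<not> singularity Z x" if x: "x \<in> cball p r" "x \<noteq> p" for x
  proof
    assume s: "singularity Z x"
    have "dist x p < e1" using x(1) r by (simp add: dist_commute)
    note F = e1(2) [OF this]
    with s have *: "pseudo_equilibrium Z x \<or> tangential_singularity Z x"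
      by (auto simp: singularity_def)
    then have S: "x \<in> Sigma0 Z"
      by (auto simp: pseudo_equilibrium_def tangential_singularity_def sliding_region_def escaping_region_def)
    then have ax: "xaxis (x $ 1) = x"
      using Sigma_iff(1) [OF Z] xaxis_of_nth by blast
    have "x $ 1 \<noteq> p $ 1" using ax x(2) xaxis_of_nth [OF p'(2)] by metis
    moreover have "dist (x $ 1) (p $ 1) < e2"
      using x(1) r dist_vec_nth_le [of x 1 p] by (simp add: dist_commute)
    ultimately have n: "Fplus Z x $ 2 \<noteq> 0" "Fminus Z x $ 2 \<noteq> 0" "cross (Fplus Z x) (Fminus Z x) \<noteq> 0"
      using e2(2) [of "x $ 1"] ax by auto
    then have "\<not> tangential_singularity Z x"
      using grad_switch_on_Sigma(2) [OF Z S] lie_deriv_on_Sigma [OF Z S]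
      by (auto simp: tangential_singularity_def)
    with * have "x \<in> sliding_region Z \<union> escaping_region Z" "sliding_field Z x $ 1 = 0"
      by (auto simp: pseudo_equilibrium_def)
    then show False
      using sliding_field_on_Sigma [OF Z S] n(3) sliding_or_escaping_imp [OF Z, of x] by auto
  qed
  moreover have "cball p r \<subseteq> region Z" using e1(2) r by (auto simp: dist_commute)
  ultimately have "isolating_radius Z p r"
    using r p(2) by (auto simp: isolating_radius_def)
  then show ?thesis ..
qed

section \<open>Regular folds\<close>

text \<open>At a fold the field is tangent to \<open>\<Sigma>\<close>, so the second Lie derivative is the derivative of the first
  one along \<open>\<Sigma>\<close>, times the first component of the field. As it does not vanish, the tangency is
  an isolated point of \<open>\<Sigma>\<close>.\<close>

lemma fold_along_xaxis:
  assumes Z: "planar_filippov Z" and p: "p \<in> Sigma0 Z" and F: "C1_on F (region Z)"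
    and fold: "lie_deriv F (switch Z) p = 0" "lie_deriv F (lie_deriv F (switch Z)) p \<noteq> 0"
  shows "F p \<noteq> 0" "F p $ 2 = 0" "\<forall>\<^sub>F s in at (p $ 1). F (xaxis s) $ 2 \<noteq> 0"
proof -
  let ?L = "lie_deriv F (switch Z)"
  have p': "p \<in> region Z" "p $ 2 = 0" "open (region Z)" "C2_on (switch Z) (region Z)"
    using p Sigma_iff [OF Z] Z by (auto simp: planar_filippov_def)
  have px: "xaxis (p $ 1) = p" using xaxis_of_nth p'(2) .
  show nz: "F p \<noteq> 0" using fold(2) by (auto simp: lie_deriv_def)
  show F2: "F p $ 2 = 0"
    using fold(1) grad_switch_on_Sigma(2) [OF Z p] by (simp add: lie_deriv_on_Sigma [OF Z p])
  have diff: "?L differentiable at p"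
    using lie_deriv_differentiable p' F by blast
  then have "((\<lambda>s. ?L (xaxis s)) has_real_derivative grad ?L p $ 1) (at (p $ 1))"
    using has_real_derivative_compose [OF has_vector_derivative_xaxis, of ?L "p $ 1"]
    by (simp add: px grad_def)
  moreover have "grad ?L p $ 1 \<noteq> 0"
    using fold(2) F2 by (auto simp: lie_deriv_def inner_vec2)
  ultimately have "\<forall>\<^sub>F s in at (p $ 1). ?L (xaxis s) \<noteq> 0"
    using fold(1) px by (intro eventually_nonzero_of_deriv_nonzero) auto
  moreover have "\<forall>\<^sub>F s in at (p $ 1). xaxis s \<in> region Z"
  proof -
    have "isCont xaxis (p $ 1)"
      using has_vector_derivative_xaxis has_vector_derivative_continuous by blast
    then show ?thesis
      using p' px unfolding isCont_def by (metis topological_tendstoD)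
  qed
  ultimately show "\<forall>\<^sub>F s in at (p $ 1). F (xaxis s) $ 2 \<noteq> 0"
  proof eventually_elim
    case (elim s)
    then have "xaxis s \<in> Sigma0 Z" by (simp add: Sigma_iff(1) [OF Z])
    with elim(1) show ?case by (auto simp: lie_deriv_on_Sigma [OF Z])
  qed
qed

lemma regular_fold_has_index_0:
  assumes Z: "planar_filippov Z" and fold: "regular_fold Z p"
  shows "has_index Z p 0"
proof -
  have p: "p \<in> Sigma0 Z" using fold by (simp add: regular_fold_def)
  have p': "p \<in> region Z" "p $ 2 = 0" and px: "xaxis (p $ 1) = p"
    using p Sigma_iff [OF Z] xaxis_of_nth by auto
  note L = lie_deriv_on_Sigma [OF Z p] and g = grad_switch_on_Sigma(2) [OF Z p]
  have diff: "Fplus Z differentiable at (xaxis (p $ 1))" "Fminus Z differentiable at (xaxis (p $ 1))"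
    using Fplus_differentiable [OF Z] Fminus_differentiable [OF Z] p'(1) px by auto
  have C1: "C1_on (Fplus Z) (region Z)" "C1_on (Fminus Z) (region Z)"
    using Z by (auto simp: planar_filippov_def)
  have nz: "Fplus Z p \<noteq> 0" "Fminus Z p \<noteq> 0" and
    one: "(Fplus Z p $ 2 = 0) \<noteq> (Fminus Z p $ 2 = 0)" and
    second: "\<forall>\<^sub>F s in at (p $ 1). Fplus Z (xaxis s) $ 2 \<noteq> 0 \<and> Fminus Z (xaxis s) $ 2 \<noteq> 0"
    using fold fold_along_xaxis [OF Z p C1(1)] fold_along_xaxis [OF Z p C1(2)] g L
      eventually_nonzero_along_xaxis [OF diff(1), of 2] eventually_nonzero_along_xaxis [OF diff(2), of 2]
    unfolding regular_fold_def px by (auto simp: eventually_conj_iff)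
  obtain d where d: "((\<lambda>s. cross (Fplus Z (xaxis s)) (Fminus Z (xaxis s))) has_real_derivative d) (at (p $ 1))"
    using differentiable_cross_along_xaxis [OF diff] .
  have "cross (Fplus Z p) (Fminus Z p) \<noteq> 0"
    using one nz by (auto simp: cross_def vec2_eq_iff)
  then have "\<forall>\<^sub>F s in at (p $ 1). cross (Fplus Z (xaxis s)) (Fminus Z (xaxis s)) \<noteq> 0"
    using DERIV_isCont [OF d] px by (intro tendsto_imp_eventually_ne) (auto simp: isCont_def)
  with second have "\<forall>\<^sub>F s in at (p $ 1). Fplus Z (xaxis s) $ 2 \<noteq> 0 \<and> Fminus Z (xaxis s) $ 2 \<noteq> 0
      \<and> cross (Fplus Z (xaxis s)) (Fminus Z (xaxis s)) \<noteq> 0"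
    by eventually_elim simp
  moreover have "singularity Z p"
    using fold by (auto simp: singularity_def tangential_singularity_def regular_fold_def)
  ultimately have "\<exists>r. isolating_radius Z p r"
    using isolating_radius_exists [OF Z p] nz by blast
  moreover have "circle_index Z p r = 0" if iso: "isolating_radius Z p r" for r
  proof -
    obtain \<Phi> :: "real \<Rightarrow> complex" where \<Phi>: "continuous_on {p $ 1 - r..p $ 1 + r} \<Phi>"
      "\<And>s. s \<in> {p $ 1 - r..p $ 1 + r} \<Longrightarrow> cplx (Fplus Z (xaxis s)) / cplx (Fminus Z (xaxis s)) = exp (\<Phi> s)"
      "circle_index Z p r = of_int (\<lfloor>(Im (\<Phi> (p $ 1 - r)) + pi) / (2 * pi)\<rfloor>
         - \<lfloor>(Im (\<Phi> (p $ 1 + r)) + pi) / (2 * pi)\<rfloor>)"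
      using circle_index_eq_floor_diff [OF Z p iso nz] by blast
    have r: "r > 0" "cball p r \<subseteq> region Z" "{x \<in> cball p r. singularity Z x} = {p}"
      using iso by (auto simp: isolating_radius_def)
    have "(Im (\<Phi> s) + pi) / (2 * pi) \<notin> \<int>" if s: "s \<in> {p $ 1 - r..p $ 1 + r}" for s
    proof
      assume "(Im (\<Phi> s) + pi) / (2 * pi) \<in> \<int>"
      then have ratio: "cplx (Fplus Z (xaxis s)) / cplx (Fminus Z (xaxis s)) \<in> \<real>\<^sub>\<le>\<^sub>0"
        using exp_in_nonpos_Reals \<Phi>(2) s by simp
      have "xaxis s \<in> cball p r" using xaxis_in_cball [OF p'(2)] s by blast
      with r(2,3) nonpos_ratio_imp_singularity [OF Z _ ratio] Sigma_iff(1) [OF Z, of "xaxis s"]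
      have "xaxis s = p" by auto
      with ratio have "cplx (Fplus Z p) / cplx (Fminus Z p) \<in> \<real>" by (metis nonpos_Reals_subset_Reals subsetD)
      then have "Im (cplx (Fplus Z p) / cplx (Fminus Z p)) = 0" by (simp add: complex_is_Real_iff)
      then have "cross (Fplus Z p) (Fminus Z p) = 0"
        using nz by (auto simp: Im_divide cross_def vec2_eq_iff sum_power2_eq_zero_iff mult.commute)
      then show False using \<open>cross (Fplus Z p) (Fminus Z p) \<noteq> 0\<close> by simp
    qed
    moreover have "continuous_on {p $ 1 - r..p $ 1 + r} (\<lambda>s. (Im (\<Phi> s) + pi) / (2 * pi))"
      using \<Phi>(1) by (intro continuous_intros) auto
    ultimately show ?thesis
      using floor_eq_of_avoids_Ints [of "p $ 1 - r" "p $ 1 + r" "\<lambda>s. (Im (\<Phi> s) + pi) / (2 * pi)"]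
        r(1) \<Phi>(3) by simp
  qed
  ultimately show ?thesis by (simp add: has_index_def)
qed

section \<open>Pseudo-equilibria\<close>

lemma parallel_opposite_ratio_nonpos:
  assumes "cross F G = 0" "F $ 2 * G $ 2 < 0"
  shows "cplx F / cplx G \<in> \<real>\<^sub>\<le>\<^sub>0"
proof -
  have G: "G $ 2 \<noteq> 0" "G \<noteq> 0" using assms(2) by auto
  have "cplx F = of_real (F $ 2 / G $ 2) * cplx G"
    using assms(1) G by (simp add: complex_eq_iff cross_def field_simps)
  then have "cplx F / cplx G = of_real (F $ 2 / G $ 2)" using G by simp
  moreover have "F $ 2 / G $ 2 \<le> 0"
    using assms(2) by (auto simp: divide_le_0_iff mult_less_0_iff)
  ultimately show ?thesis by (simp only: nonpos_Reals_of_real_iff)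
qed

text \<open>The fields lie on opposite sides of \<open>\<Sigma>\<close> along the whole diameter, so their quotient never is a
  positive real, and \<open>v = Im \<Phi> / 2\<pi>\<close> has the same integer part at both ends. The floors in the index
  formula are those of \<open>v + 1/2\<close>, hence determined by the sign of the sine, which is opposite to that
  of the determinant \<open>g\<close>; and \<open>g\<close> vanishes only at the centre, with nonzero derivative.\<close>

lemma pseudo_equilibrium_circle_index:
  assumes Z: "planar_filippov Z" and p: "p \<in> Sigma0 Z" and iso: "isolating_radius Z p r"
    and opp: "Fplus Z p $ 2 * Fminus Z p $ 2 < 0"
    and D: "cross (Fplus Z p) (Fminus Z p) = 0"
      "((\<lambda>s. cross (Fplus Z (xaxis s)) (Fminus Z (xaxis s))) has_real_derivative d) (at (p $ 1))" "d \<noteq> 0"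
  shows "circle_index Z p r = - sgn d"
proof -
  let ?a = "p $ 1"
  let ?I = "{p $ 1 - r..p $ 1 + r}"
  define g where "g s = cross (Fplus Z (xaxis s)) (Fminus Z (xaxis s))" for s
  define h where "h s = Fplus Z (xaxis s) $ 2 * Fminus Z (xaxis s) $ 2" for s
  have r: "r > 0" "cball p r \<subseteq> region Z" "{x \<in> cball p r. singularity Z x} = {p}"
    using iso by (auto simp: isolating_radius_def)
  have p2: "p $ 2 = 0" and px: "xaxis ?a = p"
    using p Sigma_iff [OF Z] xaxis_of_nth by auto
  have nz: "Fplus Z p \<noteq> 0" "Fminus Z p \<noteq> 0" using opp by auto
  obtain \<Phi> :: "real \<Rightarrow> complex" where \<Phi>: "continuous_on ?I \<Phi>"
    "\<And>s. s \<in> ?I \<Longrightarrow> cplx (Fplus Z (xaxis s)) / cplx (Fminus Z (xaxis s)) = exp (\<Phi> s)"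
    "circle_index Z p r = of_int (\<lfloor>(Im (\<Phi> (?a - r)) + pi) / (2 * pi)\<rfloor>
       - \<lfloor>(Im (\<Phi> (?a + r)) + pi) / (2 * pi)\<rfloor>)"
    using circle_index_eq_floor_diff [OF Z p iso nz] by blast
  define v where "v s = Im (\<Phi> s) / (2 * pi)" for s
  have S: "xaxis s \<in> Sigma0 Z" if "s \<in> ?I" for s
    using that r(2) xaxis_in_cball [OF p2, of s r] by (auto simp: Sigma_iff [OF Z])
  have nsing: "\<not> singularity Z (xaxis s)" if "s \<in> ?I" "s \<noteq> ?a" for s
  proof -
    have "xaxis s \<noteq> p" using that(2) xaxis_nth(1) [of s] by auto
    then show ?thesis using that(1) r(3) xaxis_in_cball [OF p2, of s r] by blast
  qed
  have diff: "Fplus Z differentiable at (xaxis s)" "Fminus Z differentiable at (xaxis s)" if "s \<in> ?I" for s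
    using S [OF that] Fplus_differentiable [OF Z] Fminus_differentiable [OF Z]
    by (auto simp: Sigma0_def)
  have cont: "continuous_on ?I g" "continuous_on ?I h"
    unfolding g_def h_def cross_def
    by (intro continuous_at_imp_continuous_on ballI continuous_intros isCont_along_xaxis diff; assumption)+
  have h_nz: "h s \<noteq> 0" if "s \<in> ?I" for s
  proof (cases "s = ?a")
    case True then show ?thesis using opp px by (auto simp: h_def)
  next
    case False
    then have "\<not> tangential_singularity Z (xaxis s)" using nsing that by (simp add: singularity_def)
    then show ?thesis
      using S [OF that] by (auto simp: h_def tangential_singularity_def lie_deriv_on_Sigma [OF Z])
  qed
  \<comment> \<open>Off \<open>p\<close> there is no tangency, so the product of the normal components keeps the sign it has at \<open>p\<close>.\<close>
  have h_neg: "h s < 0" if "s \<in> ?I" for s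
    by (rule same_sign_of_nonvanishing [OF cont(2) h_nz, of ?a s])
      (use that r(1) opp px in \<open>auto simp: h_def\<close>)
  have v_Ints: "v s \<notin> \<int>" if s: "s \<in> ?I" for s
  proof
    assume "v s \<in> \<int>"
    then have "exp (\<Phi> s) = of_real (exp (Re (\<Phi> s)))" by (intro exp_Im_in_Ints) (simp add: v_def)
    moreover have "Fminus Z (xaxis s) \<noteq> 0" using h_nz [OF s] by (auto simp: h_def)
    ultimately have "cplx (Fplus Z (xaxis s)) = of_real (exp (Re (\<Phi> s))) * cplx (Fminus Z (xaxis s))"
      using \<Phi>(2) [OF s] by (simp add: divide_eq_eq)
    then have "Fplus Z (xaxis s) $ 2 = exp (Re (\<Phi> s)) * Fminus Z (xaxis s) $ 2"
      by (simp add: complex_eq_iff)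
    then have "h s = exp (Re (\<Phi> s)) * (Fminus Z (xaxis s) $ 2)\<^sup>2"
      by (simp add: h_def power2_eq_square)
    then have "h s \<ge> 0" by simp
    then show False using h_neg [OF s] by linarith
  qed
  \<comment> \<open>The imaginary part of \<open>F\<^sup>+ / F\<^sup>-\<close> is \<open>-g\<close> over a positive number.\<close>
  have sin_v: "sgn (sin (2 * pi * v s)) = - sgn (g s)" if s: "s \<in> ?I" for s
  proof -
    let ?G = "Fminus Z (xaxis s)"
    have G: "?G \<noteq> 0" using h_nz [OF s] by (auto simp: h_def)
    then have n: "(?G $ 1)\<^sup>2 + (?G $ 2)\<^sup>2 > 0" 
      by (simp flip: norm_vec2)
    have "exp (Re (\<Phi> s)) * sin (Im (\<Phi> s)) = - g s / ((?G $ 1)\<^sup>2 + (?G $ 2)\<^sup>2)"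
      using arg_cong [OF \<Phi>(2) [OF s], of Im] 
      by (simp add: Im_divide Im_exp g_def cross_def algebra_simps)
    then have "sgn (exp (Re (\<Phi> s)) * sin (Im (\<Phi> s))) = sgn (- g s / ((?G $ 1)\<^sup>2 + (?G $ 2)\<^sup>2))"
      by simp
    then have "sgn (sin (Im (\<Phi> s))) = - sgn (g s)"
      using n by (simp add: sgn_mult sgn_divide sgn_minus)
    then show ?thesis by (simp add: v_def)
  qed
  have g_nz: "g s \<noteq> 0" if s: "s \<in> ?I" "s \<noteq> ?a" for s
  proof
    assume "g s = 0"
    then have "cplx (Fplus Z (xaxis s)) / cplx (Fminus Z (xaxis s)) \<in> \<real>\<^sub>\<le>\<^sub>0"
      using h_neg [OF s(1)] unfolding g_def h_def by (rule parallel_opposite_ratio_nonpos)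
    with nonpos_ratio_imp_singularity [OF Z S [OF s(1)]] nsing [OF s] show False by blast
  qed
  have ends: "?a - r \<in> ?I" "?a + r \<in> ?I" using r(1) by auto
  have floor_v: "\<lfloor>v (?a - r)\<rfloor> = \<lfloor>v (?a + r)\<rfloor>"
  proof (rule floor_eq_of_avoids_Ints [OF _ _ v_Ints])
    show "continuous_on ?I v" unfolding v_def using \<Phi>(1) by (intro continuous_intros) auto
  qed (use r(1) in auto)
  have v_half: "(Im (\<Phi> s) + pi) / (2 * pi) = v s + 1/2" for s
    by (simp add: v_def field_simps)
  have g_der: "(g has_real_derivative d) (at ?a)" and g_a: "g ?a = 0"
    using D px by (simp_all add: g_def [abs_def])
  consider "d < 0" | "d > 0" using D(3) by linarith
  then show ?thesis
  proof cases
    case 1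
    note g_sign = sign_at_endpoints [OF r(1) cont(1) g_nz g_der 1 g_a]
    have "sin (2 * pi * v (?a - r)) < 0" "sin (2 * pi * v (?a + r)) > 0"
      using sin_v [OF ends(1)] sin_v [OF ends(2)] g_sign by (simp_all add: sgn_1_pos sgn_1_neg)
    then have "\<lfloor>v (?a - r) + 1/2\<rfloor> = \<lfloor>v (?a + r)\<rfloor> + 1" "\<lfloor>v (?a + r) + 1/2\<rfloor> = \<lfloor>v (?a + r)\<rfloor>"
      using floor_plus_half [of "v (?a - r)"] floor_plus_half [of "v (?a + r)"] floor_v
      by simp_all
    then show ?thesis using 1 unfolding \<Phi>(3) v_half by simp
  next
    case 2
    have "continuous_on ?I (\<lambda>s. - g s)" "((\<lambda>s. - g s) has_real_derivative - d) (at ?a)"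
      using cont(1) g_der by (auto intro: continuous_on_minus DERIV_minus)
    then have "- g (?a - r) > 0" "- g (?a + r) < 0"
      using sign_at_endpoints [of r ?a "\<lambda>s. - g s" "- d"] r(1) g_nz 2 g_a by auto
    then have "sin (2 * pi * v (?a - r)) > 0" "sin (2 * pi * v (?a + r)) < 0"
      using sin_v [OF ends(1)] sin_v [OF ends(2)] by (simp_all add: sgn_1_pos sgn_1_neg)
    then have "\<lfloor>v (?a - r) + 1/2\<rfloor> = \<lfloor>v (?a + r)\<rfloor>" "\<lfloor>v (?a + r) + 1/2\<rfloor> = \<lfloor>v (?a + r)\<rfloor> + 1"
      using floor_plus_half [of "v (?a - r)"] floor_plus_half [of "v (?a + r)"] floor_v
      by simp_all
    then show ?thesis using 2 unfolding \<Phi>(3) v_half by simp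
  qed
qed

text \<open>The product in the conclusion is the derivative of \<open>det (F\<^sup>+|F\<^sup>-)\<close> along \<open>\<Sigma>\<close>: since the determinant
  vanishes at \<open>p\<close>, differentiating the quotient for the sliding field only involves the derivative of
  the numerator.\<close>

lemma hyperbolic_pseudo_equilibrium_has_index:
  assumes Z: "planar_filippov Z" and hyp: "hyperbolic_pseudo_equilibrium Z p"
  shows "has_index Z p (- sgn (sliding_deriv Z p * (Fminus Z p $ 2 - Fplus Z p $ 2)))"
proof -
  define D where "D s = cross (Fplus Z (xaxis s)) (Fminus Z (xaxis s))" for s
  define E where "E s = Fminus Z (xaxis s) $ 2 - Fplus Z (xaxis s) $ 2" for s
  have pe: "p \<in> sliding_region Z \<union> escaping_region Z" "sliding_field Z p = 0" "sliding_deriv Z p \<noteq> 0"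
    using hyp by (auto simp: hyperbolic_pseudo_equilibrium_def pseudo_equilibrium_def)
  have p: "p \<in> Sigma0 Z" using pe(1) by (auto simp: sliding_region_def escaping_region_def)
  have p': "p \<in> region Z" "p $ 2 = 0" "open (region Z)" and px: "xaxis (p $ 1) = p"
    using p Sigma_iff [OF Z] xaxis_of_nth Z by (auto simp: planar_filippov_def)
  have opp: "Fplus Z p $ 2 * Fminus Z p $ 2 < 0" and Ep: "E (p $ 1) \<noteq> 0"
    using pe(1) sliding_or_escaping_imp [OF Z, of p] by (auto simp: E_def px mult_less_0_iff)
  then have nz: "Fplus Z p \<noteq> 0" "Fminus Z p \<noteq> 0" by auto
  have Dp: "D (p $ 1) = 0"
    using sliding_field_on_Sigma [OF Z p] pe(2) Ep by (simp add: D_def E_def px)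
  have diff: "Fplus Z differentiable at (xaxis (p $ 1))" "Fminus Z differentiable at (xaxis (p $ 1))"
    using Fplus_differentiable [OF Z] Fminus_differentiable [OF Z] p'(1) px by auto
  obtain d where d: "(D has_real_derivative d) (at (p $ 1))"
    using differentiable_cross_along_xaxis [OF diff] unfolding D_def [abs_def] .
  obtain f g where "((\<lambda>s. Fplus Z (xaxis s) $ 2) has_real_derivative f) (at (p $ 1))"
    "((\<lambda>s. Fminus Z (xaxis s) $ 2) has_real_derivative g) (at (p $ 1))"
    using differentiable_along_xaxis [OF diff(1)] differentiable_along_xaxis [OF diff(2)] by metis
  then have "(E has_real_derivative g - f) (at (p $ 1))"
    unfolding E_def [abs_def] by (intro DERIV_diff)
  from DERIV_divide [OF d this Ep]
  have quot: "((\<lambda>s. D s / E s) has_real_derivative d / E (p $ 1)) (at (p $ 1))"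
    using Ep by (simp add: Dp)
  have "isCont xaxis (p $ 1)"
    using has_vector_derivative_xaxis has_vector_derivative_continuous by blast
  then have "\<forall>\<^sub>F s in nhds (p $ 1). xaxis s \<in> region Z"
    using p' px by (metis isCont_def tendsto_at_iff_tendsto_nhds topological_tendstoD)
  then have "\<forall>\<^sub>F s in nhds (p $ 1). sliding_field Z (xaxis s) $ 1 = D s / E s"
    by eventually_elim (simp add: sliding_field_on_Sigma [OF Z] Sigma_iff [OF Z] D_def E_def)
  from DERIV_cong_ev [OF refl this refl] quot
  have "((\<lambda>s. sliding_field Z (xaxis s) $ 1) has_real_derivative d / E (p $ 1)) (at (p $ 1))"
    by blast
  then have "sliding_deriv Z p = d / E (p $ 1)"
    unfolding sliding_deriv_def xaxis_def by (rule DERIV_imp_deriv)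
  then have d_eq: "d = sliding_deriv Z p * (Fminus Z p $ 2 - Fplus Z p $ 2)"
    using Ep px by (simp add: E_def)
  then have d_nz: "d \<noteq> 0" using pe(3) Ep px by (simp add: E_def)
  have "\<forall>\<^sub>F s in at (p $ 1). Fplus Z (xaxis s) $ 2 \<noteq> 0" "\<forall>\<^sub>F s in at (p $ 1). Fminus Z (xaxis s) $ 2 \<noteq> 0"
    using opp px by (auto intro!: eventually_nonzero_along_xaxis diff)
  moreover have "\<forall>\<^sub>F s in at (p $ 1). D s \<noteq> 0"
    using eventually_nonzero_of_deriv_nonzero [OF d d_nz Dp] .
  ultimately have "\<forall>\<^sub>F s in at (p $ 1). Fplus Z (xaxis s) $ 2 \<noteq> 0 \<and> Fminus Z (xaxis s) $ 2 \<noteq> 0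
      \<and> cross (Fplus Z (xaxis s)) (Fminus Z (xaxis s)) \<noteq> 0"
    by eventually_elim (simp add: D_def)
  moreover have "singularity Z p" using pe by (simp add: singularity_def pseudo_equilibrium_def)
  ultimately have "\<exists>r. isolating_radius Z p r"
    using isolating_radius_exists [OF Z p _ nz] by blast
  moreover have "circle_index Z p r = - sgn d" if "isolating_radius Z p r" for r
    using pseudo_equilibrium_circle_index [OF Z p that opp _ d [unfolded D_def] d_nz] Dp px
    by (simp add: D_def)
  ultimately show ?thesis by (simp add: has_index_def d_eq)
qed

theorem proposition10:
  fixes Z :: filippov and p :: "real^2"
  assumes "planar_filippov Z"
    and "generic_Sigma_singularity Z p"
  shows "(regular_fold Z p \<longrightarrow> has_index Z p 0) \<and>
         (hyperbolic_pseudo_node Z p \<longrightarrow> has_index Z p 1) \<and>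
         (hyperbolic_pseudo_saddle Z p \<longrightarrow> has_index Z p (- 1))"
proof (intro conjI impI)
  note signs = sliding_or_escaping_imp [OF assms(1), of p]
  show "has_index Z p 0" if "regular_fold Z p"
    using regular_fold_has_index_0 [OF assms(1) that] .
  show "has_index Z p 1" if node: "hyperbolic_pseudo_node Z p"
  proof -
    have "sliding_deriv Z p * (Fminus Z p $ 2 - Fplus Z p $ 2) < 0"
      using node signs by (auto simp: hyperbolic_pseudo_node_def mult_less_0_iff)
    then show ?thesis
      using hyperbolic_pseudo_equilibrium_has_index [OF assms(1), of p] node
      by (auto simp: hyperbolic_pseudo_node_def)
  qed
  show "has_index Z p (- 1)" if saddle: "hyperbolic_pseudo_saddle Z p"
  proof -
    have "sliding_deriv Z p * (Fminus Z p $ 2 - Fplus Z p $ 2) > 0"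
      using saddle signs by (auto simp: hyperbolic_pseudo_saddle_def zero_less_mult_iff)
    then show ?thesis
      using hyperbolic_pseudo_equilibrium_has_index [OF assms(1), of p] saddle
      by (auto simp: hyperbolic_pseudo_saddle_def)
  qed
qed

end
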